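(* Let $\mathfrak{u} \in \langle \Sigma \rangle$. Then \[ (\mathrm{Id} \otimes \Delta) \Delta(\mathfrak{u})=(\Delta \otimes \mathrm{Id})\Delta(\mathfrak{u}). \]
   Context: Let $\mathbb F_q$ be the finite field with $q$ elements, of characteristic $p$. Let $\Sigma=\{x_n\}_{n\geq 1}$ be an alphabet with weight $w(x_n)=n$; let $\langle\Sigma\rangle$ be the set of words over $\Sigma$ (the empty word is denoted $1$; the weight of a word is the sum of the weights of its letters), and let $\mathfrak C=\mathbb F_q\langle\Sigma\rangle$ be the $\mathbb F_q$-vector space with basis $\langle\Sigma\rangle$, equipped with concatenation. A nonempty word is written $\mathfrak a=x_a\mathfrak a_-$, where $x_a$ is its first letter. For $a,b,i\in\mathbb N$ put $\Delta^i_{a,b}=(-1)^{a-1}\binom{i-1}{a-1}+(-1)^{b-1}\binom{i-1}{b-1}\in\mathbb F_p$ if $(q-1)\mid i$ and $0<i<a+b$, and $\Delta^i_{a,b}=0$ otherwise. Define $\mathbb F_q$-bilinear products $\diamond$ (diamond) and $\sqcup\!\sqcup$ (shuffle) on $\mathfrak C$ recursively by $1\diamond\mathfrak a=\mathfrak a\diamond 1=\mathfrak a$, $1\sqcup\!\sqcup\mathfrak a=\mathfrak a\sqcup\!\sqcup 1=\mathfrak a$, and for nonempty words $\mathfrak a,\mathfrak b$: $\mathfrak a\diamond\mathfrak b=x_{a+b}(\mathfrak a_-\sqcup\!\sqcup\mathfrak b_-)+\sum_{i+j=a+b}\Delta^j_{a,b}\,x_i(x_j\sqcup\!\sqcup(\mathfrak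 a_-\sqcup\!\sqcup\mathfrak b_-))$, $\mathfrak a\sqcup\!\sqcup\mathfrak b=x_a(\mathfrak a_-\sqcup\!\sqcup\mathfrak b)+x_b(\mathfrak a\sqcup\!\sqcup\mathfrak b_-)+\mathfrak a\diamond\mathfrak b$. The triangle product is $1\triangleright\mathfrak a=\mathfrak a\triangleright 1=\mathfrak a$ and $\mathfrak a\triangleright\mathfrak b=x_a(\mathfrak a_-\sqcup\!\sqcup\mathfrak b)$ for nonempty $\mathfrak a,\mathfrak b$. On $\mathfrak C\otimes\mathfrak C$ the shuffle product is taken componentwise. The coproduct $\Delta:\mathfrak C\to\mathfrak C\otimes\mathfrak C$ is the $\mathbb F_q$-linear map defined on words by induction on weight: $\Delta(1)=1\otimes 1$, $\Delta(x_1)=1\otimes x_1+x_1\otimes 1$; if $\mathfrak u=x_u\mathfrak v$ has depth $>1$ and $\Delta(x_u)=1\otimes x_u+\sum a_u\otimes b_u$, $\Delta(\mathfrak v)=\sum a_{\mathfrak v}\otimes b_{\mathfrak v}$, then $\Delta(\mathfrak u)=1\otimes\mathfrak u+\sum(a_u\triangleright a_{\mathfrak v})\otimes(b_u\sqcup\!\sqcup b_{\mathfrak v})$; and for $w\geq 2$, $\Delta(x_w)=\Delta(x_1)\sqcup\!\sqcup\Delta(x_{w-1})-\Delta(x_1x_{w-1})-\Delta(x_{w-1}x_1)-\sum_{0<j<w}\Delta^j_{1,w-1}\Delta(x_{w-j}x_j)$. *)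

theory Defs
  imports Complex_Main "HOL-Library.Poly_Mapping" "HOL-Library.Cardinality"
begin

typedef letter = "{n::nat. 0 < n}" morphisms letter_weight X
  by auto

type_synonym word = "letter list"

definition weight :: "word \<Rightarrow> nat" where
  "weight u = (\<Sum>x\<leftarrow>u. letter_weight x)"

text \<open>
  The vector space with basis \<open>'v\<close> over the field \<open>'a\<close> is the type \<open>'v \<Rightarrow>\<^sub>0 'a\<close> of finitely
  supported functions.  The tensor product of the spaces with bases \<open>'v\<close> and \<open>'w\<close> is the space
  with basis \<open>'v \<times> 'w\<close>, a pair standing for the tensor of its two basis elements.
\<close>

definition basis :: "'v \<Rightarrow> ('v \<Rightarrow>\<^sub>0 'a::field)" where
  "basis v = Poly_Mapping.single v 1"

definition scale :: "'a::field \<Rightarrow> ('v \<Rightarrow>\<^sub>0 'a) \<Rightarrow> ('v \<Rightarrow>\<^sub>0 'a)" where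
  "scale c p = Poly_Mapping.map ((*) c) p"

definition linear_ext :: "('v \<Rightarrow> ('w \<Rightarrow>\<^sub>0 'a)) \<Rightarrow> ('v \<Rightarrow>\<^sub>0 'a::field) \<Rightarrow> ('w \<Rightarrow>\<^sub>0 'a)" where
  "linear_ext f p = (\<Sum>v\<in>Poly_Mapping.keys p. scale (Poly_Mapping.lookup p v) (f v))"

definition bilinear_ext ::
  "('u \<Rightarrow> 'v \<Rightarrow> ('w \<Rightarrow>\<^sub>0 'a)) \<Rightarrow> ('u \<Rightarrow>\<^sub>0 'a::field) \<Rightarrow> ('v \<Rightarrow>\<^sub>0 'a) \<Rightarrow> ('w \<Rightarrow>\<^sub>0 'a)" where
  "bilinear_ext f p r = linear_ext (\<lambda>u. linear_ext (f u) r) p"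

definition tensor :: "('v \<Rightarrow>\<^sub>0 'a::field) \<Rightarrow> ('w \<Rightarrow>\<^sub>0 'a) \<Rightarrow> ('v \<times> 'w \<Rightarrow>\<^sub>0 'a)" where
  "tensor = bilinear_ext (\<lambda>v w. basis (v, w))"

definition tensor_map ::
  "(('v \<Rightarrow>\<^sub>0 'a::field) \<Rightarrow> ('v' \<Rightarrow>\<^sub>0 'a)) \<Rightarrow> (('w \<Rightarrow>\<^sub>0 'a) \<Rightarrow> ('w' \<Rightarrow>\<^sub>0 'a)) \<Rightarrow>
   ('v \<times> 'w \<Rightarrow>\<^sub>0 'a) \<Rightarrow> ('v' \<times> 'w' \<Rightarrow>\<^sub>0 'a)" where
  "tensor_map f g = linear_ext (\<lambda>(v, w). tensor (f (basis v)) (g (basis w)))"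

definition tensor_assoc :: "(('u \<times> 'v) \<times> 'w \<Rightarrow>\<^sub>0 'a::field) \<Rightarrow> ('u \<times> 'v \<times> 'w \<Rightarrow>\<^sub>0 'a)" where
  "tensor_assoc = linear_ext (\<lambda>((u, v), w). basis (u, v, w))"

lemma linear_ext_cong [fundef_cong]:
  "p = r \<Longrightarrow> (\<And>v. v \<in> Poly_Mapping.keys r \<Longrightarrow> f v = g v) \<Longrightarrow> linear_ext f p = linear_ext g r"
  unfolding linear_ext_def by (auto intro: sum.cong)

definition prepend :: "letter \<Rightarrow> (word \<Rightarrow>\<^sub>0 'a::field) \<Rightarrow> (word \<Rightarrow>\<^sub>0 'a)" where
  "prepend x = linear_ext (\<lambda>u. basis (x # u))"

text \<open>\<open>delta_coeff a b i\<close> is \<open>\<Delta>\<^bsup>i\<^esup>\<^bsub>a,b\<^esub>\<close> for \<open>a, b \<ge> 1\<close>, with \<open>q = CARD('a)\<close>.\<close>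

definition delta_coeff :: "nat \<Rightarrow> nat \<Rightarrow> nat \<Rightarrow> 'a::{field, finite}" where
  "delta_coeff a b i =
    (if (CARD('a) - 1) dvd i \<and> 0 < i \<and> i < a + b
     then (- 1) ^ (a - 1) * of_nat ((i - 1) choose (a - 1))
        + (- 1) ^ (b - 1) * of_nat ((i - 1) choose (b - 1))
     else 0)"

function (sequential)
  diamond_word :: "word \<Rightarrow> word \<Rightarrow> (word \<Rightarrow>\<^sub>0 'a::{field, finite})" and
  shuffle_word :: "word \<Rightarrow> word \<Rightarrow> (word \<Rightarrow>\<^sub>0 'a::{field, finite})"
where
  "diamond_word [] v = basis v"
| "diamond_word u [] = basis u"
| "diamond_word (x # u) (y # v) =
    (let a = letter_weight x; b = letter_weight y in
     prepend (X (a + b)) (shuffle_word u v)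
     + (\<Sum>j\<in>{0<..<a + b}. scale (delta_coeff a b j)
          (prepend (X (a + b - j)) (linear_ext (\<lambda>w. shuffle_word [X j] w) (shuffle_word u v)))))"
| "shuffle_word [] v = basis v"
| "shuffle_word u [] = basis u"
| "shuffle_word (x # u) (y # v) =
    prepend x (shuffle_word u (y # v)) + prepend y (shuffle_word (x # u) v)
    + diamond_word (x # u) (y # v)"
  by pat_completeness auto

lemma letter_weight_pos: "0 < letter_weight x"
  using letter_weight by auto

lemma letter_weight_X: "0 < n \<Longrightarrow> letter_weight (X n) = n"
  by (simp add: X_inverse)

lemma weight_simps [simp]:
  "weight [] = 0" "weight (x # u) = letter_weight x + weight u"
  by (simp_all add: weight_def)

lemma keys_scale: "Poly_Mapping.keys (scale c p) \<subseteq> Poly_Mapping.keys p"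
  by (auto simp: scale_def in_keys_iff Poly_Mapping.map.rep_eq when_def)

lemma keys_linear_ext:
  "Poly_Mapping.keys (linear_ext f p) \<subseteq> (\<Union>v\<in>Poly_Mapping.keys p. Poly_Mapping.keys (f v))"
  unfolding linear_ext_def
  by (rule order.trans[OF Poly_Mapping.keys_sum]) (rule UN_mono[OF order.refl keys_scale])

lemma keys_prepend: "Poly_Mapping.keys (prepend x p) \<subseteq> (#) x ` Poly_Mapping.keys p"
  unfolding prepend_def
  by (rule order.trans[OF keys_linear_ext]) (auto simp: basis_def)

lemma weight_product_partial:
  "diamond_word_shuffle_word_dom TYPE('a::{field, finite}) (Inl (u, v)) \<Longrightarrow>
     \<forall>w\<in>Poly_Mapping.keys (diamond_word u v :: word \<Rightarrow>\<^sub>0 'a). weight w = weight u + weight v"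
  "diamond_word_shuffle_word_dom TYPE('a) (Inr (u', v')) \<Longrightarrow>
     \<forall>w\<in>Poly_Mapping.keys (shuffle_word u' v' :: word \<Rightarrow>\<^sub>0 'a). weight w = weight u' + weight v'"
proof (induction u v and u' v' rule: diamond_word_shuffle_word.pinduct)
  case (3 x u y v)
  let ?a = "letter_weight x" and ?b = "letter_weight y"
  let ?S = "shuffle_word u v :: word \<Rightarrow>\<^sub>0 'a"
  let ?T = "\<lambda>j. prepend (X (?a + ?b - j)) (linear_ext (shuffle_word [X j]) ?S)"
  have ab: "0 < ?a" "0 < ?b" by (rule letter_weight_pos)+
  have S: "\<forall>w\<in>Poly_Mapping.keys ?S. weight w = weight u + weight v"
    using 3(2)[OF refl refl] .
  have head: "weight w = weight (x # u) + weight (y # v)"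
    if "w \<in> Poly_Mapping.keys (prepend (X (?a + ?b)) ?S)" for w
    using that S ab keys_prepend[of "X (?a + ?b)" ?S] by (auto simp: letter_weight_X)
  have tail: "weight w = weight (x # u) + weight (y # v)"
    if j: "j \<in> {0<..<?a + ?b}" and w: "w \<in> Poly_Mapping.keys (?T j)" for w j
  proof -
    obtain w' where w': "w = X (?a + ?b - j) # w'"
      "w' \<in> Poly_Mapping.keys (linear_ext (shuffle_word [X j]) ?S)"
      using subsetD[OF keys_prepend w] by (elim imageE) simp
    obtain c where c: "c \<in> Poly_Mapping.keys ?S"
      "w' \<in> Poly_Mapping.keys (shuffle_word [X j] c :: word \<Rightarrow>\<^sub>0 'a)"
      using subsetD[OF keys_linear_ext w'(2)] by (elim UN_E) simp
    have "weight w' = weight [X j] + weight c"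
      using 3(4)[OF refl refl j c(1)] c(2) by blast
    then show ?thesis
      using w' c(1) S j by (auto simp: letter_weight_X)
  qed
  have eq: "(diamond_word (x # u) (y # v) :: word \<Rightarrow>\<^sub>0 'a) =
      prepend (X (?a + ?b)) ?S + (\<Sum>j\<in>{0<..<?a + ?b}. scale (delta_coeff ?a ?b j) (?T j))"
    using 3(1) by (simp add: diamond_word.psimps Let_def)
  show ?case
  proof
    fix w assume "w \<in> Poly_Mapping.keys (diamond_word (x # u) (y # v) :: word \<Rightarrow>\<^sub>0 'a)"
    then consider "w \<in> Poly_Mapping.keys (prepend (X (?a + ?b)) ?S)"
      | "w \<in> Poly_Mapping.keys (\<Sum>j\<in>{0<..<?a + ?b}. scale (delta_coeff ?a ?b j) (?T j))"
      unfolding eq by (auto dest!: subsetD[OF Poly_Mapping.keys_add])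
    then show "weight w = weight (x # u) + weight (y # v)"
    proof cases
      case 1
      then show ?thesis by (rule head)
    next
      case 2
      obtain j where "j \<in> {0<..<?a + ?b}"
        "w \<in> Poly_Mapping.keys (scale (delta_coeff ?a ?b j) (?T j))"
        using subsetD[OF Poly_Mapping.keys_sum 2] by (elim UN_E) simp
      then show ?thesis using tail subsetD[OF keys_scale] by metis
    qed
  qed
next
  case (6 x u y v)
  have eq: "(shuffle_word (x # u) (y # v) :: word \<Rightarrow>\<^sub>0 'a) =
      prepend x (shuffle_word u (y # v)) + prepend y (shuffle_word (x # u) v)
      + diamond_word (x # u) (y # v)"
    using 6(1) by (simp add: shuffle_word.psimps)
  show ?case
  proof
    fix w assume "w \<in> Poly_Mapping.keys (shuffle_word (x # u) (y # v) :: word \<Rightarrow>\<^sub>0 'a)"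
    then consider "w \<in> (#) x ` Poly_Mapping.keys (shuffle_word u (y # v) :: word \<Rightarrow>\<^sub>0 'a)"
      | "w \<in> (#) y ` Poly_Mapping.keys (shuffle_word (x # u) v :: word \<Rightarrow>\<^sub>0 'a)"
      | "w \<in> Poly_Mapping.keys (diamond_word (x # u) (y # v) :: word \<Rightarrow>\<^sub>0 'a)"
      unfolding eq
      by (auto dest!: subsetD[OF Poly_Mapping.keys_add] subsetD[OF keys_prepend])
    then show "weight w = weight (x # u) + weight (y # v)"
      using 6(2-4) by cases auto
  qed
qed (simp_all add: diamond_word.psimps shuffle_word.psimps basis_def)

termination
proof (relation "measure (case_sum (\<lambda>(u, v). 2 * (weight u + weight v))
                                   (\<lambda>(u, v). 2 * (weight u + weight v) + 1))", goal_cases)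
  case (4 x u y v a b j w)
  then have "weight w = weight u + weight v"
    using bspec[OF weight_product_partial(2)[OF 4(5)] 4(4)] by simp
  with 4 show ?case by (auto simp: letter_weight_X)
next
  case (2 x u y v)
  then show ?case using letter_weight_pos[of x] letter_weight_pos[of y] by simp
next
  case (3 x u y v)
  then show ?case using letter_weight_pos[of x] letter_weight_pos[of y] by simp
next
  case (5 x u y v)
  then show ?case using letter_weight_pos[of x] by simp
next
  case (6 x u y v)
  then show ?case using letter_weight_pos[of y] by simp
qed simp_all

definition shuffle :: "(word \<Rightarrow>\<^sub>0 'a::{field, finite}) \<Rightarrow> (word \<Rightarrow>\<^sub>0 'a) \<Rightarrow> (word \<Rightarrow>\<^sub>0 'a)" where
  "shuffle = bilinear_ext shuffle_word"

definition diamond :: "(word \<Rightarrow>\<^sub>0 'a::{field, finite}) \<Rightarrow> (word \<Rightarrow>\<^sub>0 'a) \<Rightarrow> (word \<Rightarrow>\<^sub>0 'a)" where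
  "diamond = bilinear_ext diamond_word"

fun triangle_word :: "word \<Rightarrow> word \<Rightarrow> (word \<Rightarrow>\<^sub>0 'a::{field, finite})" where
  "triangle_word [] v = basis v"
| "triangle_word u [] = basis u"
| "triangle_word (x # u) (y # v) = prepend x (shuffle_word u (y # v))"

definition triangle :: "(word \<Rightarrow>\<^sub>0 'a::{field, finite}) \<Rightarrow> (word \<Rightarrow>\<^sub>0 'a) \<Rightarrow> (word \<Rightarrow>\<^sub>0 'a)" where
  "triangle = bilinear_ext triangle_word"

text \<open>
  Given bilinear products \<open>f\<close> and \<open>g\<close>, \<open>tensor_product f g\<close> is the bilinear product with
  \<open>(a \<otimes> b, c \<otimes> d) \<mapsto> f a c \<otimes> g b d\<close>.
\<close>

definition tensor_product ::
  "((word \<Rightarrow>\<^sub>0 'a::field) \<Rightarrow> (word \<Rightarrow>\<^sub>0 'a) \<Rightarrow> (word \<Rightarrow>\<^sub>0 'a)) \<Rightarrow>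
   ((word \<Rightarrow>\<^sub>0 'a) \<Rightarrow> (word \<Rightarrow>\<^sub>0 'a) \<Rightarrow> (word \<Rightarrow>\<^sub>0 'a)) \<Rightarrow>
   (word \<times> word \<Rightarrow>\<^sub>0 'a) \<Rightarrow> (word \<times> word \<Rightarrow>\<^sub>0 'a) \<Rightarrow> (word \<times> word \<Rightarrow>\<^sub>0 'a)" where
  "tensor_product f g =
    bilinear_ext (\<lambda>(a, b) (c, d). tensor (f (basis a) (basis c)) (g (basis b) (basis d)))"

text \<open>
  In the clause for words of depth greater than 1, the difference \<open>\<Delta>(x) - 1 \<otimes> x\<close> is the sum
  \<open>\<Sum> a\<^sub>u \<otimes> b\<^sub>u\<close> in \<open>\<Delta>(x\<^sub>u) = 1 \<otimes> x\<^sub>u + \<Sum> a\<^sub>u \<otimes> b\<^sub>u\<close>.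
\<close>

function coproduct_word :: "word \<Rightarrow> (word \<times> word \<Rightarrow>\<^sub>0 'a::{field, finite})" where
  "coproduct_word [] = basis ([], [])"
| "coproduct_word [x] =
    (let w = letter_weight x in
     if w = 1 then basis ([], [x]) + basis ([x], [])
     else tensor_product shuffle shuffle (coproduct_word [X 1]) (coproduct_word [X (w - 1)])
        - coproduct_word [X 1, X (w - 1)]
        - coproduct_word [X (w - 1), X 1]
        - (\<Sum>j\<in>{0<..<w}. scale (delta_coeff 1 (w - 1) j) (coproduct_word [X (w - j), X j])))"
| "coproduct_word (x # y # v) =
    basis ([], x # y # v)
    + tensor_product triangle shuffle
        (coproduct_word [x] - basis ([], [x])) (coproduct_word (y # v))"
  by pat_completeness auto

termination
proof (relation "measure (\<lambda>u. 2 * weight u + (if length u = 1 then 1 else 0))", goal_cases)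
  case (2 x w)
  then show ?case using letter_weight_pos[of x] by (simp add: letter_weight_X)
next
  case (3 x w)
  then show ?case using letter_weight_pos[of x] by (simp add: letter_weight_X)
next
  case (4 x w)
  then show ?case using letter_weight_pos[of x] by (simp add: letter_weight_X)
next
  case (5 x w)
  then show ?case using letter_weight_pos[of x] by (simp add: letter_weight_X)
next
  case (6 x w j)
  then show ?case by (simp add: letter_weight_X)
next
  case (7 x y v)
  then show ?case using letter_weight_pos[of y] by simp
next
  case (8 x y v)
  then show ?case using letter_weight_pos[of x] by simp
qed simp

definition coproduct :: "(word \<Rightarrow>\<^sub>0 'a::{field, finite}) \<Rightarrow> (word \<times> word \<Rightarrow>\<^sub>0 'a)" where
  "coproduct = linear_ext coproduct_word"

end

theory Submission
  imports Defs "HOL-Computational_Algebra.Formal_Laurent_Series"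
begin

text \<open>
  Commutativity and associativity of the shuffle product are read off a faithful model. For a
  sequence of linearly independent elements \<open>t\<^sub>0, t\<^sub>1, \<dots>\<close> of an infinite extension field, send the
  letter \<open>x\<^sub>a\<close> at level \<open>d\<close> to the sum of \<open>v\<^sup>-\<^sup>a\<close> over the affine space \<open>t\<^sub>d
      + span(t\<^sub>0, \<dots>, t\<^sub>d\<^sub>-\<^sub>1)\<close>,
  and a word to the corresponding nested sum. Partial fractions show that nested sums multiply
  by the shuffle product, and comparing poles at \<open>t\<^sub>d = 0\<close> shows that they are linearly independent.

  Write \<open>a \<prec> b = x\<^sub>a(a\<^sub>- \<squnion> b)\<close> (zero for \<open>a = 1\<close>) and \<open>\<Delta>'(u) = \<Delta>(u) - 1 \<otimes> u\<close>. Associativity gives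
  \<open>\<Delta>'(u \<prec> v) = \<Delta>'(u) (\<prec> \<otimes> \<squnion>) \<Delta>(v)\<close> wherever \<open>\<Delta>\<close> is multiplicative in lower weight, which
  reduces multiplicativity of \<open>\<Delta>\<close> to pairs of letters. These follow from the case \<open>x\<^sub>1 \<squnion> x\<^sub>n\<close>, which
  is the definition of \<open>\<Delta>(x\<^sub>n\<^sub>+\<^sub>1)\<close>, by writing \<open>x\<^sub>a\<^sub>+\<^sub>1\<close> as \<open>x\<^sub>1 \<squnion> x\<^sub>a\<close> minus words of depth 2. The
  formula for \<open>\<Delta>'(u \<prec> v)\<close> and multiplicativity then propagate coassociativity from smaller weights.
\<close>

section \<open>Linear maps on free vector spaces\<close>

named_theorems lin_intros

lemma lookup_scale [simp]: "Poly_Mapping.lookup (scale c p) v = c * Poly_Mapping.lookup p v"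
  by (simp add: scale_def Poly_Mapping.map.rep_eq when_def)

lemma lookup_basis: "Poly_Mapping.lookup (basis v) w = (if v = w then 1 else 0)"
  by (simp add: basis_def lookup_single when_def)

lemma keys_basis [simp]: "Poly_Mapping.keys (basis v :: _ \<Rightarrow>\<^sub>0 'a::field) = {v}"
  by (simp add: basis_def)

lemma vector_space_scale: "vector_space (scale :: 'a::field \<Rightarrow> ('v \<Rightarrow>\<^sub>0 'a) \<Rightarrow> _)"
  by unfold_locales (auto intro!: poly_mapping_eqI simp: lookup_add algebra_simps)

interpretation free: vector_space "scale :: 'a::field \<Rightarrow> ('v \<Rightarrow>\<^sub>0 'a) \<Rightarrow> _"
  by (rule vector_space_scale)

abbreviation lin :: "(('v \<Rightarrow>\<^sub>0 'a::field) \<Rightarrow> ('w \<Rightarrow>\<^sub>0 'a)) \<Rightarrow> bool" where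
  "lin \<equiv> Vector_Spaces.linear scale scale"

definition bilin :: "(('u \<Rightarrow>\<^sub>0 'a::field) \<Rightarrow> ('v \<Rightarrow>\<^sub>0 'a) \<Rightarrow> ('w \<Rightarrow>\<^sub>0 'a)) \<Rightarrow> bool" where
  "bilin B \<longleftrightarrow> (\<forall>p. lin (B p)) \<and> (\<forall>q. lin (\<lambda>p. B p q))"

lemma lin_iff:
  "lin f \<longleftrightarrow> (\<forall>p q. f (p + q) = f p + f q) \<and> (\<forall>c p. f (scale c p) = scale c (f p))"
  by (simp add: Vector_Spaces.linear_iff vector_space_scale)

lemma linear_on_free:
  assumes "Vector_Spaces.linear scale s f"
  shows "f p = (\<Sum>v\<in>Poly_Mapping.keys p. s (Poly_Mapping.lookup p v) (f (basis v)))"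
proof -
  interpret f: Vector_Spaces.linear scale s f by fact
  have "p = (\<Sum>v\<in>Poly_Mapping.keys p. scale (Poly_Mapping.lookup p v) (basis v))"
  proof (rule poly_mapping_eqI)
    fix k
    have "Poly_Mapping.lookup p k =
        (\<Sum>v\<in>Poly_Mapping.keys p. if v = k then Poly_Mapping.lookup p v else 0)"
      by (simp add: in_keys_iff)
    also have "\<dots> = (\<Sum>v\<in>Poly_Mapping.keys p. Poly_Mapping.lookup p v *
        Poly_Mapping.lookup (basis v) k)"
      by (rule sum.cong) (simp_all add: lookup_basis)
    finally show "Poly_Mapping.lookup p k = Poly_Mapping.lookup
        (\<Sum>v\<in>Poly_Mapping.keys p. scale (Poly_Mapping.lookup p v) (basis v)) k"
      by (simp add: lookup_sum)
  qed
  then have "f p = f (\<Sum>v\<in>Poly_Mapping.keys p. scale (Poly_Mapping.lookup p v) (basis v))"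
    by (rule arg_cong)
  also have "\<dots> = (\<Sum>v\<in>Poly_Mapping.keys p. s (Poly_Mapping.lookup p v) (f (basis v)))"
    by (simp add: f.sum f.scale)
  finally show ?thesis .
qed

text \<open>A linear map at \<open>p\<close> depends only on its values on the support of
  \<open>p\<close>. Asking for agreement just there lets inductions on weight apply their hypothesis
  to the basis elements that occur in \<open>p\<close>.\<close>

lemma linear_eq_on_keys:
  assumes "Vector_Spaces.linear scale s f" "Vector_Spaces.linear scale s g"
    and "\<And>v. v \<in> Poly_Mapping.keys p \<Longrightarrow> f (basis v) = g (basis v)"
  shows "f p = g p"
  unfolding linear_on_free[OF assms(1), of p] linear_on_free[OF assms(2), of p]
  by (rule sum.cong) (simp_all add: assms(3))

lemma bilin_eq_on_keys:
  assumes "\<And>q. lin (\<lambda>p. F p q)" "\<And>p. lin (F p)" "\<And>q. lin (\<lambda>p. G p q)" "\<And>p. lin (G p)"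
    and "\<And>u v. u \<in> Poly_Mapping.keys p \<Longrightarrow> v \<in> Poly_Mapping.keys q \<Longrightarrow>
      F (basis u) (basis v) = G (basis u) (basis v)"
  shows "F p q = G p q"
proof (rule linear_eq_on_keys[OF assms(1) assms(3)])
  fix u assume u: "u \<in> Poly_Mapping.keys p"
  show "F (basis u) q = G (basis u) q"
    by (rule linear_eq_on_keys[OF assms(2,4)]) (rule assms(5)[OF u])
qed

lemma lin_eqI:
  assumes "lin f" "lin g" "\<And>v. f (basis v) = g (basis v)"
  shows "f p = g p"
  using assms by (rule linear_eq_on_keys)

lemma bilin_eqI:
  assumes "\<And>q. lin (\<lambda>p. F p q)" "\<And>p. lin (F p)" "\<And>q. lin (\<lambda>p. G p q)" "\<And>p. lin (G p)"
    and "\<And>u v. F (basis u) (basis v) = G (basis u) (basis v)"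
  shows "F p q = G p q"
  using assms by (rule bilin_eq_on_keys)

lemma trilin_eqI:
  assumes "\<And>q r. lin (\<lambda>p. F p q r)" "\<And>p r. lin (\<lambda>q. F p q r)" "\<And>p q. lin (F p q)"
    and "\<And>q r. lin (\<lambda>p. G p q r)" "\<And>p r. lin (\<lambda>q. G p q r)" "\<And>p q. lin (G p q)"
    and "\<And>u v w. F (basis u) (basis v) (basis w) = G (basis u) (basis v) (basis w)"
  shows "F p q r = G p q r"
proof (rule lin_eqI[OF assms(1) assms(4)])
  show "F (basis u) q r = G (basis u) q r" for u
    by (rule bilin_eqI[of "F (basis u)" "G (basis u)"]) (rule assms)+
qed

lemma quadrilin_eqI:
  assumes "\<And>q r s. lin (\<lambda>p. F p q r s)" "\<And>p r s. lin (\<lambda>q. F p q r s)"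
      "\<And>p q s. lin (\<lambda>r. F p q r s)" "\<And>p q r. lin (F p q r)"
    and "\<And>q r s. lin (\<lambda>p. G p q r s)" "\<And>p r s. lin (\<lambda>q. G p q r s)"
      "\<And>p q s. lin (\<lambda>r. G p q r s)" "\<And>p q r. lin (G p q r)"
    and "\<And>u v w x. F (basis u) (basis v) (basis w) (basis x) =
      G (basis u) (basis v) (basis w) (basis x)"
  shows "F p q r s = G p q r s"
proof (rule lin_eqI[OF assms(1) assms(5)])
  show "F (basis u) q r s = G (basis u) q r s" for u
    by (rule trilin_eqI[of "F (basis u)" "G (basis u)"]) (rule assms)+
qed

lemma lin_comp: "lin f \<Longrightarrow> lin g \<Longrightarrow> lin (\<lambda>p. f (g p))"
  by (simp add: lin_iff)

lemma lin_ident [lin_intros]: "lin (\<lambda>p. p)"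
  by (simp add: lin_iff)

lemma lin_id [lin_intros]: "lin id"
  by (simp add: lin_iff)

lemma lin_zero [lin_intros]: "lin (\<lambda>p. 0)"
  by (simp add: lin_iff)

lemma lin_add [lin_intros]: "lin f \<Longrightarrow> lin g \<Longrightarrow> lin (\<lambda>p. f p + g p)"
  by (simp add: lin_iff free.scale_right_distrib)

lemma lin_diff [lin_intros]: "lin f \<Longrightarrow> lin g \<Longrightarrow> lin (\<lambda>p. f p - g p)"
  by (simp add: lin_iff free.scale_right_diff_distrib)

lemma lin_scale [lin_intros]: "lin f \<Longrightarrow> lin (\<lambda>p. scale c (f p))"
  by (simp add: lin_iff free.scale_right_distrib free.scale_left_commute)

lemma lin_sum [lin_intros]: "(\<And>i. i \<in> I \<Longrightarrow> lin (f i)) \<Longrightarrow> lin (\<lambda>p. \<Sum>i\<in>I. f i p)"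
  by (simp add: lin_iff sum.distrib free.scale_sum_right)

lemma linD:
  assumes "lin f"
  shows "f (p + q) = f p + f q" "f (p - q) = f p - f q" "f (scale c p) = scale c (f p)"
    "f (sum g I) = (\<Sum>i\<in>I. f (g i))" "f 0 = 0"
proof -
  interpret Vector_Spaces.linear scale scale f by fact
  show "f (p + q) = f p + f q" "f (p - q) = f p - f q" "f (scale c p) = scale c (f p)"
    "f (sum g I) = (\<Sum>i\<in>I. f (g i))" "f 0 = 0"
    by (simp_all add: add diff scale sum)
qed

lemma bilin_comp1: "bilin B \<Longrightarrow> lin g \<Longrightarrow> lin (\<lambda>p. B (g p) q)"
  by (auto simp: bilin_def intro: lin_comp[of "\<lambda>p. B p q"])

lemma bilin_comp2: "bilin B \<Longrightarrow> lin g \<Longrightarrow> lin (\<lambda>p. B q (g p))"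
  by (auto simp: bilin_def intro: lin_comp[of "B q"])

lemmas bilin_comp = bilin_comp1 bilin_comp2

lemma bilinI: "(\<And>q. lin (\<lambda>p. B p q)) \<Longrightarrow> (\<And>p. lin (B p)) \<Longrightarrow> bilin B"
  by (simp add: bilin_def)

lemma bilinD1: "bilin B \<Longrightarrow> lin (\<lambda>p. B p q)"
  by (simp add: bilin_def)

lemma bilinD2: "bilin B \<Longrightarrow> lin (B p)"
  by (simp add: bilin_def)

lemmas bilin_left = linD[OF bilinD1]
lemmas bilin_right = linD[OF bilinD2]

section \<open>Linear and bilinear extensions, and the operations of the statement\<close>

lemma linear_ext_superset:
  "linear_ext f p = (\<Sum>v\<in>A. scale (Poly_Mapping.lookup p v) (f v))"
  if "finite A" "Poly_Mapping.keys p \<subseteq> A"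
  unfolding linear_ext_def
  by (rule sum.mono_neutral_left) (use that in \<open>auto simp: in_keys_iff\<close>)

lemma lin_linear_ext: "lin (linear_ext f)"
proof -
  have "linear_ext f (p + q) = linear_ext f p + linear_ext f q" for p q
  proof -
    let ?A = "Poly_Mapping.keys p \<union> Poly_Mapping.keys q"
    have "Poly_Mapping.keys (p + q) \<subseteq> ?A" by (rule Poly_Mapping.keys_add)
    then show ?thesis
      by (simp add: linear_ext_superset[of ?A] lookup_add free.scale_left_distrib sum.distrib)
  qed
  moreover have "linear_ext f (scale c p) = scale c (linear_ext f p)" for c p
    by (simp add: linear_ext_superset[of "Poly_Mapping.keys p"] keys_scale free.scale_sum_right)
  ultimately show ?thesis by (simp add: lin_iff)
qed

lemmas lin_linear_ext_comp [lin_intros] = lin_comp[OF lin_linear_ext]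

lemma linear_ext_basis [simp]: "linear_ext f (basis v) = f v"
  by (simp add: linear_ext_def lookup_basis)

lemma bilin_bilinear_ext: "bilin (bilinear_ext f)"
  unfolding bilinear_ext_def
proof (rule bilinI)
  show "lin (\<lambda>p. linear_ext (\<lambda>u. linear_ext (f u) q) p)" for q
    by (rule lin_linear_ext)
  show "lin (\<lambda>q. linear_ext (\<lambda>u. linear_ext (f u) q) p)" for p
    unfolding linear_ext_def[of "\<lambda>u. linear_ext (f u) _"] by (intro lin_intros)
qed

lemma bilinear_ext_basis [simp]: "bilinear_ext f (basis u) (basis v) = f u v"
  by (simp add: bilinear_ext_def)

lemma lin_prepend: "lin (prepend x)"
  unfolding prepend_def by (rule lin_linear_ext)

lemma prepend_basis [simp]: "prepend x (basis u) = basis (x # u)"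
  by (simp add: prepend_def)

lemma bilin_tensor: "bilin tensor"
  unfolding tensor_def by (rule bilin_bilinear_ext)

lemma tensor_basis [simp]: "tensor (basis u) (basis v) = basis (u, v)"
  by (simp add: tensor_def)

lemma lin_tensor_map: "lin (tensor_map f g)"
  unfolding tensor_map_def by (rule lin_linear_ext)

lemma lin_tensor_assoc: "lin tensor_assoc"
  unfolding tensor_assoc_def by (rule lin_linear_ext)

lemma bilin_shuffle: "bilin shuffle"
  unfolding shuffle_def by (rule bilin_bilinear_ext)

lemma shuffle_basis: "shuffle (basis u) (basis v) = shuffle_word u v"
  by (simp add: shuffle_def)

lemma lin_coproduct: "lin coproduct"
  unfolding coproduct_def by (rule lin_linear_ext)

lemma coproduct_basis [simp]: "coproduct (basis u) = coproduct_word u"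
  by (simp add: coproduct_def)

lemmas lin_ops_comp [lin_intros] =
  lin_comp[OF lin_prepend] lin_comp[OF lin_tensor_map] lin_comp[OF lin_tensor_assoc]
  lin_comp[OF lin_coproduct]
  bilin_comp[OF bilin_tensor] bilin_comp[OF bilin_shuffle]

section \<open>Products and maps on tensor products\<close>

text \<open>\<open>tensor_product\<close> for arbitrary index types, as needed for triple tensor products.\<close>

definition tprod ::
  "(('u \<Rightarrow>\<^sub>0 'a::field) \<Rightarrow> ('v \<Rightarrow>\<^sub>0 'a) \<Rightarrow> ('w \<Rightarrow>\<^sub>0 'a)) \<Rightarrow>
   (('x \<Rightarrow>\<^sub>0 'a) \<Rightarrow> ('y \<Rightarrow>\<^sub>0 'a) \<Rightarrow> ('z \<Rightarrow>\<^sub>0 'a)) \<Rightarrow>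
   ('u \<times> 'x \<Rightarrow>\<^sub>0 'a) \<Rightarrow> ('v \<times> 'y \<Rightarrow>\<^sub>0 'a) \<Rightarrow> ('w \<times> 'z \<Rightarrow>\<^sub>0 'a)" where
  "tprod f g =
    bilinear_ext (\<lambda>(a, b) (c, d). tensor (f (basis a) (basis c)) (g (basis b) (basis d)))"

lemma tensor_product_eq_tprod: "tensor_product f g = tprod f g"
  by (simp add: tensor_product_def tprod_def)

lemma bilin_tprod: "bilin (tprod f g)"
  unfolding tprod_def by (rule bilin_bilinear_ext)

lemmas lin_tprod_comp [lin_intros] = bilin_comp[OF bilin_tprod]

lemma tprod_basis: "tprod f g (basis (a, b)) (basis (c, d)) =
    tensor (f (basis a) (basis c)) (g (basis b) (basis d))"
  by (simp add: tprod_def)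

lemma tprod_tensor:
  assumes f: "bilin f" and g: "bilin g"
  shows "tprod f g (tensor p q) (tensor r s) = tensor (f p r) (g q s)"
  by (rule quadrilin_eqI[where F="\<lambda>p q r s. tprod f g (tensor p q) (tensor r s)"
      and G="\<lambda>p q r s. tensor (f p r) (g q s)"])
    (intro lin_intros bilin_comp[OF f] bilin_comp[OF g] | simp add: tprod_basis)+

lemma tensor_map_basis: "tensor_map f g (basis (a, b)) = tensor (f (basis a)) (g (basis b))"
  by (simp add: tensor_map_def)

lemma tensor_map_tensor:
  assumes f: "lin f" and g: "lin g"
  shows "tensor_map f g (tensor p q) = tensor (f p) (g q)"
  by (rule bilin_eqI[where F="\<lambda>p q. tensor_map f g (tensor p q)"
      and G="\<lambda>p q. tensor (f p) (g q)"])
    (intro lin_intros lin_comp[OF f] lin_comp[OF g] | simp add: tensor_map_basis)+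

lemma tensor_assoc_basis: "tensor_assoc (basis ((a, b), c)) = basis (a, b, c)"
  by (simp add: tensor_assoc_def)

lemma tensor_assoc_tensor: "tensor_assoc (tensor (tensor p q) r) = tensor p (tensor q r)"
  by (rule trilin_eqI[where F="\<lambda>p q r. tensor_assoc (tensor (tensor p q) r)"
      and G="\<lambda>p q r. tensor p (tensor q r)"])
    (intro lin_intros | simp add: tensor_assoc_basis)+

text \<open>Both sides are trilinear, so pure tensors suffice. Allowing different products in the
  four positions covers the mixed law between \<open>left_shuffle\<close> and \<open>shuffle\<close>
  along with plain associativity.\<close>

lemma tprod_assoc:
  assumes f: "bilin f1" "bilin f2" "bilin f3" "bilin f4"
    and g: "bilin g1" "bilin g2" "bilin g3" "bilin g4"
    and "\<And>p q r. f1 (f2 p q) r = f3 p (f4 q r)" "\<And>p q r. g1 (g2 p q) r = g3 p (g4 q r)"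
  shows "tprod f1 g1 (tprod f2 g2 P Q) R = tprod f3 g3 P (tprod f4 g4 Q R)"
proof (rule trilin_eqI[where F="\<lambda>P Q R. tprod f1 g1 (tprod f2 g2 P Q) R"
      and G="\<lambda>P Q R. tprod f3 g3 P (tprod f4 g4 Q R)"])
  fix u v w
  show "tprod f1 g1 (tprod f2 g2 (basis u) (basis v)) (basis w) =
    tprod f3 g3 (basis u) (tprod f4 g4 (basis v) (basis w))"
    by (cases u; cases v; cases w)
      (simp add: tprod_tensor f g assms(9,10) flip: tensor_basis)
qed (intro lin_intros)+

lemma tprod_interchange:
  assumes f: "bilin f1" "bilin f2" "bilin f3" "bilin f4" "bilin f5"
    and g: "bilin g1" "bilin g2" "bilin g3" "bilin g4" "bilin g5"
    and "\<And>p q r s. f1 (f2 p q) (f3 r s) = f2 (f4 p r) (f5 q s)"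
      "\<And>p q r s. g1 (g2 p q) (g3 r s) = g2 (g4 p r) (g5 q s)"
  shows "tprod f1 g1 (tprod f2 g2 P Q) (tprod f3 g3 R S) =
    tprod f2 g2 (tprod f4 g4 P R) (tprod f5 g5 Q S)"
proof (rule quadrilin_eqI[where F="\<lambda>P Q R S. tprod f1 g1 (tprod f2 g2 P Q) (tprod f3 g3 R S)"
      and G="\<lambda>P Q R S. tprod f2 g2 (tprod f4 g4 P R) (tprod f5 g5 Q S)"])
  fix u v w x
  show "tprod f1 g1 (tprod f2 g2 (basis u) (basis v)) (tprod f3 g3 (basis w) (basis x)) =
    tprod f2 g2 (tprod f4 g4 (basis u) (basis w)) (tprod f5 g5 (basis v) (basis x))"
    by (cases u; cases v; cases w; cases x)
      (simp add: tprod_tensor f g assms(11,12) flip: tensor_basis)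
qed (intro lin_intros)+

text \<open>The maps \<open>f1\<close>, \<open>f2\<close> may differ from \<open>f\<close> because
  the reduced coproduct of a left shuffle involves the reduced coproduct of the left argument but
  the full coproduct of the right one.\<close>

lemma tensor_map_tprod:
  assumes bil: "bilin m" "bilin n" "bilin m'" "bilin n'"
    and l: "lin f" "lin f1" "lin f2" "lin g" "lin g1" "lin g2"
    and "\<And>p q. f (m p q) = m' (f1 p) (f2 q)" "\<And>p q. g (n p q) = n' (g1 p) (g2 q)"
  shows "tensor_map f g (tprod m n P Q) = tprod m' n' (tensor_map f1 g1 P) (tensor_map f2 g2 Q)"
proof (rule bilin_eqI[where F="\<lambda>P Q. tensor_map f g (tprod m n P Q)"
      and G="\<lambda>P Q. tprod m' n' (tensor_map f1 g1 P) (tensor_map f2 g2 Q)"])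
  fix u v
  show "tensor_map f g (tprod m n (basis u) (basis v)) =
    tprod m' n' (tensor_map f1 g1 (basis u)) (tensor_map f2 g2 (basis v))"
    by (cases u; cases v)
      (simp add: tprod_tensor tensor_map_tensor bil l assms(11,12) flip: tensor_basis)
qed (intro lin_intros)+

lemma tensor_assoc_tprod:
  assumes bil: "bilin f" "bilin g" "bilin h"
  shows "tensor_assoc (tprod (tprod f g) h P Q) =
    tprod f (tprod g h) (tensor_assoc P) (tensor_assoc Q)"
proof (rule bilin_eqI[where F="\<lambda>P Q. tensor_assoc (tprod (tprod f g) h P Q)"
      and G="\<lambda>P Q. tprod f (tprod g h) (tensor_assoc P) (tensor_assoc Q)"])
  fix u v
  show "tensor_assoc (tprod (tprod f g) h (basis u) (basis v)) =
    tprod f (tprod g h) (tensor_assoc (basis u)) (tensor_assoc (basis v))"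
    by (cases u; cases v; cases "fst u"; cases "fst v")
      (simp add: tprod_tensor tensor_assoc_tensor bilin_tprod bil flip: tensor_basis)
qed (intro lin_intros)+

section \<open>A faithful model of the shuffle product\<close>

lemma finite_field_power_card_minus_1:
  fixes x :: "'a::{field, finite}"
  assumes "x \<noteq> 0"
  shows "x ^ (CARD('a) - 1) = 1"
proof -
  \<comment> \<open>Multiplication by \<open>x\<close> permutes the nonzero elements, so their
    product is unchanged.\<close>
  have "(\<Prod>y\<in>UNIV - {0}. x * y) = (\<Prod>y\<in>UNIV - {0}. y)"
    by (rule prod.reindex_bij_witness[of _ "\<lambda>y. y / x" "\<lambda>y. x * y"]) (use assms in auto)
  moreover have "(\<Prod>y\<in>UNIV - {0}. x * y) = x ^ (CARD('a) - 1) * (\<Prod>y\<in>UNIV - {0}. y)"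
    by (simp add: prod.distrib card_Diff_singleton)
  ultimately show ?thesis by simp
qed

lemma of_nat_CARD_eq_0: "of_nat CARD('a) = (0 :: 'a::{field, finite})"
proof -
  \<comment> \<open>Translation by 1 permutes the field, so the sum of all elements is
    unchanged.\<close>
  have "(\<Sum>x\<in>UNIV. x + 1) = (\<Sum>x\<in>UNIV. x :: 'a)"
    by (rule sum.reindex_bij_witness[of _ "\<lambda>x. x - 1" "\<lambda>x. x + 1"]) auto
  then show ?thesis by (simp add: sum.distrib)
qed

text \<open>If q - 1 divides j, every summand is 1. Otherwise some nonzero \<open>y\<close> has
  \<open>y ^ j \<noteq> 1\<close>, and rescaling the summation variable by \<open>y\<close>
  multiplies the sum by \<open>y ^ j\<close>. This is the source of the divisibility condition in
  \<open>delta_coeff\<close>.\<close>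

lemma sum_powers_finite_field:
  "(\<Sum>x\<in>UNIV - {0}. inverse x ^ j) = (if (CARD('a) - 1) dvd j then
      - 1 else 0 :: 'a::{field, finite})"
proof (cases "(CARD('a) - 1) dvd j")
  case True
  then obtain k where k: "j = (CARD('a) - 1) * k" ..
  have "(\<Sum>x\<in>UNIV - {0}. inverse x ^ j) = (\<Sum>x\<in>UNIV - {0 :: 'a}. 1 :: 'a)"
    by (rule sum.cong) (simp_all add: k power_mult finite_field_power_card_minus_1 del: One_nat_def)
  also have "\<dots> = of_nat (CARD('a) - 1)" by (simp add: card_Diff_singleton)
  also have "\<dots> = - 1"
    using of_nat_CARD_eq_0[where 'a='a] finite_UNIV_card_ge_0[where 'a='a] by (simp add:
        of_nat_diff)
  finally show ?thesis using True by simp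
next
  case False
  let ?q = "CARD('a) - 1" and ?r = "j mod (CARD('a) - 1)"
  have r: "?r \<noteq> 0" using False by (auto simp: dvd_eq_mod_eq_0)
  have q: "0 < ?q"
    using card_mono[of UNIV "{0, 1 :: 'a}"] by simp
  have pow: "y ^ j = y ^ ?r" if "y \<noteq> 0" for y :: 'a
  proof -
    have "y ^ j = y ^ (?q * (j div ?q) + ?r)" by (simp only: mult_div_mod_eq)
    also have "\<dots> = y ^ ?r"
      unfolding power_add power_mult by (simp add: finite_field_power_card_minus_1 that del:
          One_nat_def)
    finally show ?thesis .
  qed
  \<comment> \<open>Otherwise all q - 1 nonzero elements would be roots of a nonzero polynomial of
    degree \<open>?r < ?q\<close>.\<close>
  have "\<exists>y::'a. y \<noteq> 0 \<and> y ^ j \<noteq> 1"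
  proof (rule ccontr)
    assume "\<not> ?thesis"
    then have *: "y ^ ?r = 1" if "y \<noteq> 0" for y :: 'a using that pow by auto
    let ?p = "monom 1 ?r - 1 :: 'a poly"
    have "coeff ?p ?r = 1" using r by simp
    then have "?p \<noteq> 0" by (metis coeff_0 zero_neq_one)
    have "card (UNIV - {0 :: 'a}) \<le> card {x. poly ?p x = 0}"
      by (rule card_mono) (use * in \<open>auto simp: poly_monom\<close>)
    also have "\<dots> \<le> degree ?p"
      using \<open>?p \<noteq> 0\<close> by (rule card_poly_roots_bound)
    also have "\<dots> \<le> ?r" by (intro degree_diff_le) (simp_all add: degree_monom_le)
    finally have "card (UNIV - {0 :: 'a}) \<le> ?r" .
    then have "?q \<le> ?r" by (simp add: card_Diff_singleton)
    then show False using mod_less_divisor[OF q, of j] by linarith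
  qed
  then obtain y :: 'a where y: "y \<noteq> 0" "y ^ j \<noteq> 1" by blast
  have "(\<Sum>x\<in>UNIV - {0}. inverse x ^ j) = (\<Sum>x\<in>UNIV - {0}. y ^ j * inverse x ^ j)"
    by (rule sum.reindex_bij_witness[of _ "\<lambda>x. x / y" "\<lambda>x. x * y"])
      (use y in \<open>auto simp: power_mult_distrib power_inverse field_simps\<close>)
  also have "\<dots> = y ^ j * (\<Sum>x\<in>UNIV - {0}. inverse x ^ j)" by (simp add: sum_distrib_left)
  finally have "(1 - y ^ j) * (\<Sum>x\<in>UNIV - {0}. inverse x ^ j) = 0" by (simp add: algebra_simps)
  then show ?thesis using y False by auto
qed

text \<open>This removes the sign \<open>(- 1) ^ j\<close> which partial fractions put before one of
  the two binomial coefficients and which \<open>delta_coeff\<close> does not have.\<close>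

lemma neg_one_power_dvd:
  assumes "(CARD('a) - 1) dvd j"
  shows "(- 1 :: 'a::{field, finite}) ^ j = 1"
proof -
  from assms obtain k where "j = (CARD('a) - 1) * k" ..
  then show ?thesis by (simp add: power_mult finite_field_power_card_minus_1 del: One_nat_def)
qed

text \<open>
  Here \<open>x\<close>, \<open>y\<close>, \<open>z\<close> stand for the inverses of \<open>v\<close>, \<open>w\<close>, \<open>w - v\<close>; multiplying the hypothesis into
  \<open>x\<^sup>a y\<^sup>b\<close> lowers the total exponent and yields Pascal's recurrence for the coefficients.
\<close>

lemma partial_fractions_Suc:
  fixes x y z :: "'k::comm_ring_1"
  assumes xy: "x * y = z * (x - y)"
  shows "x ^ Suc a * y ^ Suc b =
    (\<Sum>k\<le>a + b. z ^ Suc k * ((- 1) ^ (k + b) * of_nat (k choose b) * x ^ (a + b + 1 - k)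
       - (- 1) ^ a * of_nat (k choose a) * y ^ (a + b + 1 - k)))"
  (is "_ = (\<Sum>k\<le>_. ?s a b k)")
proof (induction "a + b" arbitrary: a b)
  case 0
  then show ?case using xy by (simp add: algebra_simps)
next
  case (Suc n)
  have step: "x ^ Suc a * y ^ Suc b = z * (x ^ Suc a * y ^ b) - z * (x ^ a * y ^ Suc b)"
  proof -
    have "x ^ Suc a * y ^ Suc b = (x * y) * (x ^ a * y ^ b)" by (simp add: algebra_simps)
    then show ?thesis unfolding xy by (simp add: algebra_simps)
  qed
  have shift: "(\<Sum>k\<le>a + b. g k) = g 0 + (\<Sum>k\<le>n. g (Suc k))" for g :: "nat \<Rightarrow> 'k"
    unfolding Suc(2)[symmetric] by (rule sum.atMost_Suc_shift)
  show ?case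
  proof (cases a)
    case 0
    then obtain b' where b: "b = Suc b'" "b' = n" using Suc(2) by (cases b) auto
    \<comment> \<open>The pure power of \<open>y\<close> left over by \<open>step\<close> is the
      summand \<open>k = 0\<close>, in which the other binomial coefficient vanishes because
      \<open>b > 0\<close>.\<close>
    have "x ^ Suc a * y ^ Suc b = z * (\<Sum>k\<le>n. ?s 0 b' k) - z * y ^ Suc b"
      using step Suc(1)[of 0 b'] by (simp add: 0 b)
    also have "\<dots> = (\<Sum>k\<le>a + b. ?s a b k)"
      unfolding shift
    proof -
      have "z * ?s 0 b' k = z ^ Suc (Suc k) * (- 1) ^ (k + b') * of_nat (k choose b') * x ^ (n + 1
          - k)
         - z ^ Suc (Suc k) * y ^ (n + 1 - k)" for k
        by (simp add: algebra_simps b)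
      moreover have "?s a b (Suc k) = z ^ Suc (Suc k) * (- 1) ^ (k + b') * of_nat (k choose b') *
          x ^ (n + 1 - k)
         - z ^ Suc (Suc k) * y ^ (n + 1 - k)" if "k \<le> n" for k
      \<comment> \<open>As \<open>b' = n\<close>, the coefficient \<open>k choose b'\<close> of the
        power of \<open>x\<close> vanishes unless \<open>k = n\<close>.\<close>
      proof (cases "k = n")
        case True
        then show ?thesis by (simp add: algebra_simps 0 b)
      next
        case False
        then show ?thesis using that by (simp add: algebra_simps 0 b binomial_eq_0)
      qed
      ultimately show "z * (\<Sum>k\<le>n. ?s 0 b' k) - z * y ^ Suc b = ?s a b 0 + (\<Sum>k\<le>n. ?s a b (Suc k))"
        by (simp add: 0 b sum_distrib_left)
    qed
    finally show ?thesis .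
  next
    case a: (Suc a')
    show ?thesis
    proof (cases b)
      case 0
      then have n: "a' = n" using Suc(2) a by simp
      have "x ^ Suc a * y ^ Suc b = z * x ^ Suc a - z * (\<Sum>k\<le>n. ?s a' 0 k)"
        using step Suc(1)[of a' 0] by (simp add: 0 n a)
      also have "\<dots> = (\<Sum>k\<le>a + b. ?s a b k)"
        unfolding shift
      proof -
        have "?s a b (Suc k) = - (z * ?s a' 0 k)" if "k \<le> n" for k
        proof (cases "k = n")
          case True
          then show ?thesis by (simp add: algebra_simps 0 n a)
        next
          case False
          then show ?thesis using that by (simp add: algebra_simps 0 n a binomial_eq_0)
        qed
        then show "z * x ^ Suc a - z * (\<Sum>k\<le>n. ?s a' 0 k) = ?s a b 0 + (\<Sum>k\<le>n. ?s a b (Suc k))"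
          by (simp add: 0 n a sum_distrib_left sum_negf)
      qed
      finally show ?thesis .
    next
      case b: (Suc b')
      have n: "n = a' + Suc b'" using Suc(2) a b by simp
      have "x ^ Suc a * y ^ Suc b = z * (\<Sum>k\<le>n. ?s a b' k) - z * (\<Sum>k\<le>n. ?s a' b k)"
        using step Suc(1)[of a b'] Suc(1)[of a' b] by (simp add: a b n)
      also have "\<dots> = (\<Sum>k\<le>n. z * ?s a b' k - z * ?s a' b k)"
        by (simp add: sum_distrib_left sum_subtractf)
      also have "\<dots> = (\<Sum>k\<le>n. ?s a b (Suc k))"
      proof (rule sum.cong[OF refl])
        fix k
        have e: "a + b' + 1 - k = a + b + 1 - Suc k" "a' + b + 1 - k = a + b + 1 - Suc k"
          by (simp_all add: a b)
        show "z * ?s a b' k - z * ?s a' b k = ?s a b (Suc k)"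
          unfolding e by (simp add: a b algebra_simps)
      qed
      \<comment> \<open>For positive \<open>a\<close> and \<open>b\<close> both binomial
        coefficients of the summand \<open>k = 0\<close> vanish.\<close>
      also have "\<dots> = (\<Sum>k\<le>a + b. ?s a b k)"
        unfolding shift by (simp add: a b)
      finally show ?thesis .
    qed
  qed
qed

text \<open>The same expansion with \<open>j = k + 1\<close> and true exponents. The sign
  \<open>(- 1) ^ (j - 1)\<close> is written as minus \<open>(- 1) ^ j\<close>, which becomes -1 as
  soon as q - 1 divides \<open>j\<close>.\<close>

lemma partial_fractions:
  fixes x y z :: "'k::comm_ring_1"
  assumes xy: "x * y = z * (x - y)" and "0 < a" "0 < b"
  shows "x ^ a * y ^ b =
    (\<Sum>j\<in>{0<..<a + b}. z ^ j * (- ((- 1) ^ j * (- 1) ^ (b - 1) * of_nat ((j - 1) choose (b - 1))) *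
        x ^ (a + b - j)
       - (- 1) ^ (a - 1) * of_nat ((j - 1) choose (a - 1)) * y ^ (a + b - j)))"
proof -
  obtain a' b' where ab: "a = Suc a'" "b = Suc b'"
    using assms by (meson gr0_implies_Suc)
  have "{0<..<a + b} = Suc ` {..a' + b'}"
  proof -
    have "j \<in> Suc ` {..a' + b'}" if "j \<in> {0<..<a + b}" for j
      using that by (cases j) (auto simp: ab)
    then show ?thesis by (auto simp: ab)
  qed
  then show ?thesis
    unfolding ab partial_fractions_Suc[OF xy]
    by (simp add: sum.reindex power_add mult.assoc)
qed

text \<open>
  Clearing denominators gives a polynomial with infinitely many roots; at \<open>t = 0\<close> only the pole of
  highest order at \<open>w = 0\<close> contributes to its value.
\<close>

lemma principal_parts_independent:
  fixes C :: "nat \<Rightarrow> 'k::field"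
  assumes inf: "infinite (UNIV :: 'k set)" and fin: "finite W" "0 \<in> W"
    and A: "finite A" "0 \<notin> A"
    and vanish: "\<And>t. (\<And>w. w \<in> W \<Longrightarrow> t + w \<noteq> 0) \<Longrightarrow>
      (\<Sum>a\<in>A. C a * (\<Sum>w\<in>W. inverse (t + w) ^ a)) = 0"
    and "a \<in> A"
  shows "C a = 0"
proof (rule ccontr)
  assume "C a \<noteq> 0"
  let ?B = "{a \<in> A. C a \<noteq> 0}"
  \<comment> \<open>The highest pole order that actually occurs; the contradiction will be that its
    coefficient \<open>C m\<close> vanishes.\<close>
  define m where "m = Max ?B"
  have B: "finite ?B" "?B \<noteq> {}" using A \<open>a \<in> A\<close> \<open>C a \<noteq> 0\<close> by auto
  have mB: "m \<in> ?B" unfolding m_def using B by (rule Max_in)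
  have le: "b \<le> m" if "b \<in> ?B" for b unfolding m_def using B(1) that by (rule Max_ge)
  have "m > 0" using mB A(2) by (cases m) auto
  define Q where "Q = (\<Sum>b\<in>?B. \<Sum>w\<in>W. smult (C b) ([:w, 1:] ^ (m - b) * (\<Prod>v\<in>W - {w}. [:v, 1:] ^ m)))"
  have Qt: "poly Q t = 0" if t: "\<And>w. w \<in> W \<Longrightarrow> t + w \<noteq> 0" for t
  proof -
    have "poly Q t = (\<Sum>b\<in>?B. \<Sum>w\<in>W. C b * ((t + w) ^ (m - b) * (\<Prod>v\<in>W - {w}. (t + v) ^ m)))"
      by (simp add: Q_def poly_sum poly_prod add.commute)
    also have "\<dots> = (\<Sum>b\<in>?B. \<Sum>w\<in>W. C b * inverse (t + w) ^ b * (\<Prod>v\<in>W. (t + v) ^ m))"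
    proof (intro sum.cong refl)
      fix b w assume b: "b \<in> ?B" and w: "w \<in> W"
      have "(t + w) ^ (m - b) = inverse (t + w) ^ b * (t + w) ^ m"
        using le[OF b] t[OF w] by (simp add: power_diff power_inverse field_simps)
      then show "C b * ((t + w) ^ (m - b) * (\<Prod>v\<in>W - {w}. (t + v) ^ m)) =
          C b * inverse (t + w) ^ b * (\<Prod>v\<in>W. (t + v) ^ m)"
        using fin w by (simp add: prod.remove[of W w])
    qed
    also have "\<dots> = (\<Sum>b\<in>?B. C b * (\<Sum>w\<in>W. inverse (t + w) ^ b)) * (\<Prod>v\<in>W. (t + v) ^ m)"
      by (simp add: sum_distrib_right sum_distrib_left mult.assoc)
    also have "(\<Sum>b\<in>?B. C b * (\<Sum>w\<in>W. inverse (t + w) ^ b)) = (\<Sum>b\<in>A. C b * (\<Sum>w\<in>W. inverse (t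
        + w) ^ b))"
      by (rule sum.mono_neutral_left) (use A in auto)
    also have "\<dots> = 0" by (rule vanish[OF t])
    finally show ?thesis by simp
  qed
  have "Q = 0"
  proof (rule ccontr)
    assume "Q \<noteq> 0"
    then have "finite ({t. poly Q t = 0} \<union> uminus ` W)" using poly_roots_finite fin by blast
    moreover have "UNIV \<subseteq> {t. poly Q t = 0} \<union> uminus ` W"
    proof
      fix t :: 'k
      show "t \<in> {t. poly Q t = 0} \<union> uminus ` W"
      proof (cases "\<exists>w\<in>W. t + w = 0")
        case True
        then show ?thesis by (auto simp: eq_neg_iff_add_eq_0)
      next
        case False
        then show ?thesis using Qt by auto
      qed
    qed
    ultimately show False using inf finite_subset by blast
  qed
  have "poly Q 0 = (\<Sum>b\<in>?B. \<Sum>w\<in>W. C b * (w ^ (m - b) * (\<Prod>v\<in>W - {w}. v ^ m)))"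
    by (simp add: Q_def poly_sum poly_prod)
  also have "\<dots> = (\<Sum>b\<in>?B. C b * (0 ^ (m - b) * (\<Prod>v\<in>W - {0}. v ^ m)))"
  proof (rule sum.cong[OF refl])
    fix b
    \<comment> \<open>For \<open>w \<noteq> 0\<close> the product still contains the factor
      \<open>0 ^ m\<close>, with \<open>m > 0\<close>.\<close>
    have "(\<Prod>v\<in>W - {w}. v ^ m) = 0" if "w \<in> W - {0}" for w
      by (rule prod_zero) (use that fin \<open>m > 0\<close> in \<open>auto intro!: bexI[of _ 0]\<close>)
    then have "(\<Sum>w\<in>W - {0}. C b * (w ^ (m - b) * (\<Prod>v\<in>W - {w}. v ^ m))) = 0"
      by (intro sum.neutral ballI) (simp only: mult_zero_right)
    then show "(\<Sum>w\<in>W. C b * (w ^ (m - b) * (\<Prod>v\<in>W - {w}. v ^ m))) =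
        C b * (0 ^ (m - b) * (\<Prod>v\<in>W - {0}. v ^ m))"
      using fin by (simp add: sum.remove[of W 0])
  qed
  also have "\<dots> = C m * (\<Prod>v\<in>W - {0}. v ^ m)"
  proof -
    have "C b * (0 ^ (m - b) * (\<Prod>v\<in>W - {0}. v ^ m)) = 0" if "b \<in> ?B - {m}" for b
      using le[of b] that by (simp add: power_0_left)
    then have "(\<Sum>b\<in>?B - {m}. C b * (0 ^ (m - b) * (\<Prod>v\<in>W - {0}. v ^ m))) = 0"
      by (intro sum.neutral ballI)
    then show ?thesis by (subst sum.remove[OF B(1) mB]) simp
  qed
  finally show False using \<open>Q = 0\<close> mB fin by auto
qed

section \<open>Flags and nested power sums\<close>

text \<open>A flag \<open>t\<^sub>0, \<dots>, t\<^sub>d\<close> is stored as a list with \<open>t\<^sub>d\<close> as its head.\<close>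

fun flag_span :: "'a::{field, finite} fls list \<Rightarrow> 'a fls set" where
  "flag_span [] = {0}"
| "flag_span (t # ts) = (\<lambda>(c, w). fls_const c * t + w) ` (UNIV \<times> flag_span ts)"

text \<open>Linear independence of the entries over the finite field, phrased one level at a
  time.\<close>

fun flag :: "'a::{field, finite} fls list \<Rightarrow> bool" where
  "flag [] = True"
| "flag (t # ts) = (t \<notin> flag_span ts \<and> flag ts)"

text \<open>If \<open>t\<close> is the d-th power of a variable and \<open>ts\<close> lists its
  lower powers, the vectors \<open>t + w\<close> are the monic polynomials of degree d, and this is
  Thakur's power sum.\<close>

definition power_sum :: "'a::{field, finite} fls \<Rightarrow> 'a fls list \<Rightarrow> nat \<Rightarrow> 'a fls" where
  "power_sum t ts a = (\<Sum>w\<in>flag_span ts. inverse (t + w) ^ a)"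

text \<open>The letters of a word are placed on strictly decreasing levels: either the top level
  \<open>t\<close> is skipped, or the first letter occupies it. On the flag of powers of a variable
  these are truncated multiple zeta values in positive characteristic.\<close>

fun nested_sum :: "'a::{field, finite} fls list \<Rightarrow> word \<Rightarrow> 'a fls" where
  "nested_sum [] u = (if u = [] then 1 else 0)"
| "nested_sum (t # ts) [] = 1"
| "nested_sum (t # ts) (x # u) =
    nested_sum ts (x # u) + power_sum t ts (letter_weight x) * nested_sum ts u"

lemma letter_weight_neq_0 [simp]: "letter_weight x \<noteq> 0"
  using letter_weight_pos[of x] by simp

lemma finite_flag_span: "finite (flag_span ts)"
  by (induction ts) auto

lemma zero_in_flag_span: "0 \<in> flag_span ts"
  by (induction ts) (auto intro!: image_eqI[of _ _ "(0, 0)"])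

lemma flag_span_add: "v \<in> flag_span ts \<Longrightarrow> w \<in> flag_span ts \<Longrightarrow> v + w \<in> flag_span ts"
proof (induction ts arbitrary: v w)
  case (Cons t ts)
  then obtain c d v' w' where "v = fls_const c * t + v'" "w = fls_const d * t + w'"
    "v' \<in> flag_span ts" "w' \<in> flag_span ts" by auto
  then show ?case
    using Cons.IH[of v' w']
    by (auto intro!: image_eqI[of _ _ "(c + d, v' + w')"] simp: algebra_simps simp flip:
        fls_plus_const)
qed simp

lemma flag_span_scale: "v \<in> flag_span ts \<Longrightarrow> fls_const c * v \<in> flag_span ts"
proof (induction ts arbitrary: v)
  case (Cons t ts)
  then obtain d v' where "v = fls_const d * t + v'" "v' \<in> flag_span ts" by auto
  then show ?case
    using Cons.IH[of v']
    by (auto intro!: image_eqI[of _ _ "(c * d, fls_const c * v')"]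
        simp: algebra_simps simp flip: fls_const_mult_const)
qed simp

lemma flag_span_uminus: "v \<in> flag_span ts \<Longrightarrow> - v \<in> flag_span ts"
  using flag_span_scale[of v ts "- 1"] by simp

lemma flag_span_diff: "v \<in> flag_span ts \<Longrightarrow> w \<in> flag_span ts \<Longrightarrow> v - w \<in> flag_span ts"
  using flag_span_add[of v ts "- w"] flag_span_uminus[of w ts] by simp

lemma flag_span_uminus_iff: "- v \<in> flag_span ts \<longleftrightarrow> v \<in> flag_span ts"
  using flag_span_uminus[of v ts] flag_span_uminus[of "- v" ts] by auto

lemma flag_span_scale_iff: "c \<noteq> 0 \<Longrightarrow> fls_const c * v \<in> flag_span ts \<longleftrightarrow> v \<in> flag_span ts"
  using flag_span_scale[of v ts c] flag_span_scale[of "fls_const c * v" ts "inverse c"]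
  by (auto simp flip: mult.assoc)

lemma nested_sum_Nil [simp]: "nested_sum ts [] = 1"
  by (cases ts) auto

text \<open>The span is stable under scaling by \<open>c\<close>, so \<open>c\<close> can be
  factored out of the whole affine space.\<close>

lemma sum_inverse_powers_translate:
  assumes "c \<noteq> 0"
  shows "(\<Sum>w\<in>flag_span ts. inverse (fls_const c * t + w) ^ j) =
    fls_const (inverse c ^ j) * power_sum t ts j"
proof -
  have "(\<Sum>w\<in>flag_span ts. inverse (fls_const c * t + w) ^ j) =
      (\<Sum>w\<in>flag_span ts. inverse (fls_const c * t + fls_const c * w) ^ j)"
    by (rule sum.reindex_bij_witness[of _ "\<lambda>w. fls_const c * w" "\<lambda>w. fls_const (inverse c) * w"])
      (use assms in \<open>auto simp: flag_span_scale simp flip: mult.assoc\<close>)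
  also have "\<dots> = (\<Sum>w\<in>flag_span ts. fls_const (inverse c ^ j) * inverse (t + w) ^ j)"
    by (simp add: power_mult_distrib fls_const_power fls_inverse_const flip: distrib_left)
  finally show ?thesis by (simp add: power_sum_def sum_distrib_left)
qed

text \<open>By independence every nonzero vector is a unique scalar multiple of some
  \<open>t + w\<close>, with \<open>t\<close> an entry of the flag and \<open>w\<close> in the span
  of the later entries of the list. The scalars contribute -1 or 0 by
  \<open>sum_powers_finite_field\<close>, and the vectors \<open>t + w\<close> contribute the power
  sums of all levels.\<close>

lemma sum_inverse_powers_flag_span:
  fixes ts :: "'a::{field, finite} fls list"
  assumes "flag ts" "0 < j"
  shows "(\<Sum>y\<in>flag_span ts - {0}. inverse y ^ j) =
    (if (CARD('a) - 1) dvd j then - nested_sum ts [X j] else 0)"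
  using assms(1)
proof (induction ts)
  case (Cons t ts)
  let ?W = "flag_span ts" and ?f = "\<lambda>(c, w). fls_const c * t + w"
  have inj: "inj_on ?f (UNIV \<times> ?W)"
  proof (rule inj_onI, clarify)
    fix c d :: 'a and v w
    assume vw: "v \<in> ?W" "w \<in> ?W" and eq: "fls_const c * t + v = fls_const d * t + w"
    have "c = d"
    proof (rule ccontr)
      assume "c \<noteq> d"
      have "fls_const (c - d) * t = w - v" using eq by (simp add: algebra_simps flip:
          fls_minus_const)
      then have "fls_const (c - d) * t \<in> ?W" using vw by (simp add: flag_span_diff)
      then show False using flag_span_scale_iff[of "c - d" t ts] \<open>c \<noteq> d\<close> Cons.prems by simp
    qed
    then show "c = d \<and> v = w" using eq by simp
  qed
  have z: "?f (0, 0) = 0" by simp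
  have "flag_span (t # ts) - {0} = ?f ` (UNIV \<times> ?W - {(0, 0)})"
    using inj_on_image_set_diff[OF inj, of "UNIV \<times> ?W" "{(0, 0)}"] zero_in_flag_span[of ts]
    by simp
  then have "(\<Sum>y\<in>flag_span (t # ts) - {0}. inverse y ^ j) =
      (\<Sum>p\<in>UNIV \<times> ?W - {(0, 0)}. inverse (?f p) ^ j)"
    using inj_on_subset[OF inj, of "UNIV \<times> ?W - {(0, 0)}"] by (simp add: sum.reindex)
  also have "UNIV \<times> ?W - {(0, 0)} = {0} \<times> (?W - {0}) \<union> (UNIV - {0}) \<times> ?W" by auto
  also have "(\<Sum>p\<in>\<dots>. inverse (?f p) ^ j) =
      (\<Sum>p\<in>{0} \<times> (?W - {0}). inverse (?f p) ^ j) + (\<Sum>p\<in>(UNIV - {0}) \<times> ?W. inverse (?f p) ^ j)"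
    by (rule sum.union_disjoint) (auto simp: finite_flag_span)
  also have "(\<Sum>p\<in>{0} \<times> (?W - {0}). inverse (?f p) ^ j) = (\<Sum>w\<in>?W - {0}. inverse w ^ j)"
    by (rule sum.reindex_bij_witness[of _ "Pair 0" snd]) auto
  also have "(\<Sum>p\<in>(UNIV - {0}) \<times> ?W. inverse (?f p) ^ j) =
      (\<Sum>c\<in>UNIV - {0}. \<Sum>w\<in>?W. inverse (fls_const c * t + w) ^ j)"
    by (simp add: sum.cartesian_product split_def)
  also have "\<dots> = (\<Sum>c\<in>UNIV - {0}. fls_const (inverse c ^ j) * power_sum t ts j)"
    by (rule sum.cong) (auto simp: sum_inverse_powers_translate)
  also have "\<dots> = fls_const (\<Sum>c\<in>UNIV - {0}. inverse c ^ j) * power_sum t ts j"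
  proof -
    have "fls_const (sum g A) = (\<Sum>c\<in>A. fls_const (g c))" for g :: "'a \<Rightarrow> 'a" and A
      by (induction A rule: infinite_finite_induct) (auto simp flip: fls_plus_const)
    then show ?thesis by (simp add: sum_distrib_right)
  qed
  finally show ?case
    using Cons assms(2) by (simp add: sum_powers_finite_field letter_weight_X)
qed simp

text \<open>Diagonal pairs give the first term. Off the diagonal, partial fractions separate
  \<open>v\<close> from \<open>w\<close> up to a power of \<open>inverse (w - v)\<close>; for a
  fixed \<open>v\<close> or \<open>w\<close> the difference runs through all nonzero vectors of the
  span, which yields the value of the letter \<open>X j\<close>.\<close>

lemma power_sum_mult:
  fixes ts :: "'a::{field, finite} fls list"
  assumes fl: "flag (t # ts)" and ab: "0 < a" "0 < b"
  shows "power_sum t ts a * power_sum t ts b = power_sum t ts (a + b) +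
    (\<Sum>j\<in>{0<..<a + b}. fls_const (delta_coeff a b j) * (power_sum t ts (a + b - j) *
        nested_sum ts [X j]))"
proof -
  let ?W = "flag_span ts"
  let ?x = "\<lambda>w. inverse (t + w)"
  let ?A = "\<lambda>j. - ((- 1) ^ j * (- 1) ^ (b - 1) * of_nat ((j - 1) choose (b - 1))) :: 'a fls"
  let ?B = "\<lambda>j. (- 1) ^ (a - 1) * of_nat ((j - 1) choose (a - 1)) :: 'a fls"
  let ?Y = "\<lambda>j. \<Sum>y\<in>?W - {0}. inverse y ^ j"
  have nz: "t + w \<noteq> 0" if "w \<in> ?W" for w
    using fl that flag_span_uminus[OF that] by (auto simp: add_eq_0_iff2)
  have pf: "?x v ^ a * ?x w ^ b = (\<Sum>j\<in>{0<..<a + b}. inverse (w - v) ^ j *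
      (?A j * ?x v ^ (a + b - j) - ?B j * ?x w ^ (a + b - j)))"
    if "v \<in> ?W" "w \<in> ?W" "v \<noteq> w" for v w
  proof (rule partial_fractions[OF _ ab])
    have "inverse x * inverse y = inverse (y - x) * (inverse x - inverse y)"
      if "x \<noteq> 0" "y \<noteq> 0" "x \<noteq> y" for x y :: "'a fls"
    proof -
      have "inverse x - inverse y = (y - x) * (inverse x * inverse y)"
        using that by (simp add: left_diff_distrib flip: mult.assoc)
      then show ?thesis using that by (simp flip: mult.assoc)
    qed
    from this[of "t + v" "t + w"]
    show "?x v * ?x w = inverse (w - v) * (?x v - ?x w)" using that nz by simp
  qed
  have Y1: "(\<Sum>w\<in>?W - {v}. inverse (w - v) ^ j) = ?Y j" if "v \<in> ?W" for v j
    by (rule sum.reindex_bij_witness[of _ "\<lambda>y. y + v" "\<lambda>w. w - v"])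
      (use that in \<open>auto simp: flag_span_add flag_span_diff\<close>)
  have Y2: "(\<Sum>v\<in>?W - {w}. inverse (w - v) ^ j) = ?Y j" if "w \<in> ?W" for w j
    by (rule sum.reindex_bij_witness[of _ "\<lambda>y. w - y" "\<lambda>v. w - v"])
      (use that in \<open>auto simp: flag_span_add flag_span_diff\<close>)
  have swap: "(\<Sum>v\<in>?W. \<Sum>w\<in>?W - {v}. g v w) = (\<Sum>w\<in>?W. \<Sum>v\<in>?W - {w}. g v w)"
    for g :: "_ \<Rightarrow> _ \<Rightarrow> 'a fls"
  proof -
    have "(\<Sum>v\<in>?W. \<Sum>w\<in>?W - {v}. g v w) = (\<Sum>v\<in>?W. \<Sum>w\<in>?W. if v = w then 0 else g v w)"
      by (intro sum.cong refl sum.mono_neutral_cong_left) (auto simp: finite_flag_span)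
    also have "\<dots> = (\<Sum>w\<in>?W. \<Sum>v\<in>?W. if v = w then 0 else g v w)" by (rule sum.swap)
    also have "\<dots> = (\<Sum>w\<in>?W. \<Sum>v\<in>?W - {w}. g v w)"
      by (intro sum.cong refl sum.mono_neutral_cong_right) (auto simp: finite_flag_span)
    finally show ?thesis .
  qed
  have off: "(\<Sum>v\<in>?W. \<Sum>w\<in>?W - {v}. inverse (w - v) ^ j *
      (A * ?x v ^ i - B * ?x w ^ i)) = (A - B) * (power_sum t ts i *
          ?Y j)" for i j and A B :: "'a fls"
  proof -
    have "(\<Sum>v\<in>?W. \<Sum>w\<in>?W - {v}. inverse (w - v) ^ j * (A * ?x v ^ i - B * ?x w ^ i)) =
        A * (\<Sum>v\<in>?W. \<Sum>w\<in>?W - {v}. ?x v ^ i * inverse (w - v) ^ j)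
        - B * (\<Sum>v\<in>?W. \<Sum>w\<in>?W - {v}. ?x w ^ i * inverse (w - v) ^ j)"
      by (simp add: sum_distrib_left right_diff_distrib sum_subtractf mult_ac)
    also have "(\<Sum>v\<in>?W. \<Sum>w\<in>?W - {v}. ?x v ^ i * inverse (w - v) ^ j) =
        (\<Sum>v\<in>?W. ?x v ^ i * ?Y j)"
      by (rule sum.cong) (simp_all add: Y1 flip: sum_distrib_left)
    also have "(\<Sum>v\<in>?W. \<Sum>w\<in>?W - {v}. ?x w ^ i * inverse (w - v) ^ j) =
        (\<Sum>w\<in>?W. ?x w ^ i * ?Y j)"
      by (subst swap, rule sum.cong) (simp_all add: Y2 flip: sum_distrib_left)
    finally show ?thesis
      by (simp add: power_sum_def sum_distrib_right algebra_simps)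
  qed
  \<comment> \<open>If q - 1 divides \<open>j\<close>, then \<open>(- 1) ^ j = 1\<close> and
    \<open>?Y j\<close> is minus the nested sum; the two minus signs turn \<open>?A j - ?B j\<close>
    into \<open>delta_coeff a b j\<close>. Otherwise both sides are 0.\<close>
  have coeff: "(?A j - ?B j) * ?Y j = fls_const (delta_coeff a b j) * nested_sum ts [X j]"
    if "j \<in> {0<..<a + b}" for j
  proof (cases "(CARD('a) - 1) dvd j")
    case True
    have ofn: "fls_const (of_nat n) = (of_nat n :: 'a fls)" for n
      by (induction n) (auto simp flip: fls_plus_const)
    have neg: "fls_const ((- 1) ^ n) = ((- 1) ^ n :: 'a fls)" for n
      by (simp add: fls_const_power)
    have "(- 1 :: 'a fls) ^ j = 1"
      using arg_cong[OF neg_one_power_dvd[OF True], of fls_const] by (simp add: neg)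
    moreover have "fls_const (delta_coeff a b j) =
        (- 1) ^ (a - 1) * of_nat ((j - 1) choose (a - 1)) + (- 1) ^ (b - 1) * (of_nat ((j
            - 1) choose (b - 1)) :: 'a fls)"
      unfolding delta_coeff_def using True that
      by (simp only: if_True greaterThanLessThan_iff simp_thms fls_plus_const[symmetric]
          fls_const_mult_const[symmetric] ofn neg)
    ultimately show ?thesis
      using fl that True by (simp add: sum_inverse_powers_flag_span algebra_simps del: One_nat_def)
  next
    case False
    then show ?thesis
      using fl that by (simp add: sum_inverse_powers_flag_span delta_coeff_def del: One_nat_def)
  qed
  have "power_sum t ts a * power_sum t ts b = (\<Sum>v\<in>?W. \<Sum>w\<in>?W. ?x v ^ a * ?x w ^ b)"
    by (simp add: power_sum_def sum_product)
  also have "\<dots> = (\<Sum>v\<in>?W. ?x v ^ (a + b) + (\<Sum>w\<in>?W - {v}. ?x v ^ a * ?x w ^ b))"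
    by (rule sum.cong) (simp_all add: sum.remove[OF finite_flag_span] power_add)
  also have "\<dots> = power_sum t ts (a + b) + (\<Sum>v\<in>?W. \<Sum>w\<in>?W - {v}. ?x v ^ a * ?x w ^ b)"
    by (simp add: sum.distrib power_sum_def)
  also have "(\<Sum>v\<in>?W. \<Sum>w\<in>?W - {v}. ?x v ^ a * ?x w ^ b) =
      (\<Sum>v\<in>?W. \<Sum>w\<in>?W - {v}. \<Sum>j\<in>{0<..<a + b}. inverse (w - v) ^ j *
      (?A j * ?x v ^ (a + b - j) - ?B j * ?x w ^ (a + b - j)))"
    by (intro sum.cong refl pf) auto
  also have "\<dots> = (\<Sum>v\<in>?W. \<Sum>j\<in>{0<..<a + b}. \<Sum>w\<in>?W - {v}. inverse (w - v) ^ j *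
      (?A j * ?x v ^ (a + b - j) - ?B j * ?x w ^ (a + b - j)))"
    by (intro sum.cong refl sum.swap)
  also have "\<dots> = (\<Sum>j\<in>{0<..<a + b}. \<Sum>v\<in>?W. \<Sum>w\<in>?W - {v}. inverse (w - v) ^ j *
      (?A j * ?x v ^ (a + b - j) - ?B j * ?x w ^ (a + b - j)))"
    by (rule sum.swap)
  also have "\<dots> = (\<Sum>j\<in>{0<..<a + b}. fls_const (delta_coeff a b j) *
      (power_sum t ts (a + b - j) * nested_sum ts [X j]))"
  proof (intro sum.cong refl)
    fix j assume j: "j \<in> {0<..<a + b}"
    have "(?A j - ?B j) * (power_sum t ts (a + b - j) * ?Y j) =
        power_sum t ts (a + b - j) * ((?A j - ?B j) * ?Y j)"
      by (rule mult.left_commute)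
    also have "\<dots> = fls_const (delta_coeff a b j) * (power_sum t ts (a + b - j) *
        nested_sum ts [X j])"
      unfolding coeff[OF j] by (rule mult.left_commute)
    finally show "(\<Sum>v\<in>?W. \<Sum>w\<in>?W - {v}. inverse (w - v) ^ j *
        (?A j * ?x v ^ (a + b - j) - ?B j * ?x w ^ (a + b - j))) =
        fls_const (delta_coeff a b j) * (power_sum t ts (a + b - j) * nested_sum ts [X j])"
      unfolding off .
  qed
  finally show ?thesis .
qed

text \<open>The counterpart of \<open>linear_ext\<close> for values in the field of Laurent series,
  where scalars act through \<open>fls_const\<close>.\<close>

definition eval_ext :: "(word \<Rightarrow> 'a fls) \<Rightarrow> (word \<Rightarrow>\<^sub>0 'a::field) \<Rightarrow> 'a fls" where
  "eval_ext f p = (\<Sum>u\<in>Poly_Mapping.keys p. fls_const (Poly_Mapping.lookup p u) * f u)"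

lemma vector_space_fls: "vector_space (\<lambda>c x :: 'a::field fls. fls_const c * x)"
  by unfold_locales (simp_all add: algebra_simps flip: fls_plus_const fls_const_mult_const)

lemma eval_ext_superset:
  "eval_ext f p = (\<Sum>u\<in>A. fls_const (Poly_Mapping.lookup p u) * f u)"
  if "finite A" "Poly_Mapping.keys p \<subseteq> A"
  unfolding eval_ext_def
  by (rule sum.mono_neutral_left) (use that in \<open>auto simp: in_keys_iff\<close>)

lemma linear_eval_ext: "Vector_Spaces.linear scale (\<lambda>c x. fls_const c * x) (eval_ext f)"
proof -
  have "eval_ext f (p + q) = eval_ext f p + eval_ext f q" for p q
  proof -
    let ?A = "Poly_Mapping.keys p \<union> Poly_Mapping.keys q"
    have "Poly_Mapping.keys (p + q) \<subseteq> ?A" by (rule Poly_Mapping.keys_add)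
    then show ?thesis
      by (simp add: eval_ext_superset[of ?A] lookup_add sum.distrib algebra_simps flip:
          fls_plus_const)
  qed
  moreover have "eval_ext f (scale c p) = fls_const c * eval_ext f p" for c p
    by (simp add: eval_ext_superset[of "Poly_Mapping.keys p"] keys_scale sum_distrib_left mult.assoc
        flip: fls_const_mult_const)
  ultimately show ?thesis
    by (simp add: Vector_Spaces.linear_iff vector_space_scale vector_space_fls)
qed

interpretation eval_ext: Vector_Spaces.linear scale "\<lambda>c x :: 'a::field fls. fls_const c *
    x" "eval_ext f"
  for f :: "word \<Rightarrow> 'a::field fls"
  by (rule linear_eval_ext)

lemma eval_ext_basis [simp]: "eval_ext f (basis u) = f u"
  by (simp add: eval_ext_def lookup_basis)

lemma eval_ext_linear_ext: "eval_ext f (linear_ext g p) = eval_ext (\<lambda>u. eval_ext f (g u)) p"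
  by (simp add: linear_ext_def eval_ext.sum eval_ext.scale eval_ext_def[of "\<lambda>u. eval_ext f (g u)"])

lemma eval_ext_prepend: "eval_ext f (prepend x p) = eval_ext (\<lambda>u. f (x # u)) p"
  by (simp add: prepend_def eval_ext_linear_ext)

lemma eval_ext_mult: "eval_ext (\<lambda>u. c * f u) p = c * eval_ext f p"
  by (simp add: eval_ext_def sum_distrib_left mult.left_commute)

lemma eval_ext_plus: "eval_ext (\<lambda>u. f u + g u) p = eval_ext f p + eval_ext g p"
  by (simp add: eval_ext_def sum.distrib distrib_left)

lemma eval_ext_mult_right: "eval_ext (\<lambda>u. f u * c) p = eval_ext f p * c"
  by (simp add: eval_ext_def sum_distrib_right mult.assoc)

lemma shuffle_word_Nil2 [simp]: "shuffle_word u [] = basis u"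
  by (cases u) auto

text \<open>Induction on the flag, for all words at once. Expanding the product at the top level
  gives four terms: neither first letter there, only the first, only the second, or both. They match
  the product one level lower and the three summands of the shuffle recursion, the case of both
  letters being \<open>power_sum_mult\<close>.\<close>

lemma nested_sum_shuffle:
  "flag ts \<Longrightarrow> eval_ext (nested_sum ts) (shuffle_word u v) = nested_sum ts u * nested_sum ts v"
proof (induction ts arbitrary: u v)
  case Nil
  show ?case
  proof (cases u)
    case u: (Cons x u')
    show ?thesis
    proof (cases v)
      case v: (Cons y v')
      have *: "eval_ext (nested_sum []) (prepend z p) = 0" for z and p :: "word \<Rightarrow>\<^sub>0 'a"
        unfolding eval_ext_prepend by (simp add: eval_ext_def)
      show ?thesis
        by (simp add: u v Let_def eval_ext.add eval_ext.sum eval_ext.scale * del: nested_sum.simps)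
          simp
    qed simp
  qed simp
next
  case (Cons t ts)
  show ?case
  proof (cases u)
    case u: (Cons x u')
    show ?thesis
    proof (cases v)
      case v: (Cons y v')
      let ?a = "letter_weight x" and ?b = "letter_weight y"
      let ?N = "nested_sum ts" and ?P = "power_sum t ts"
      have IH: "eval_ext ?N (shuffle_word u v) = ?N u * ?N v" for u v
        using Cons by simp
      have pre: "eval_ext (nested_sum (t # ts)) (prepend z p) =
          eval_ext ?N (prepend z p) + ?P (letter_weight z) *
              eval_ext ?N p" for z and p :: "word \<Rightarrow>\<^sub>0 'a"
        by (simp add: eval_ext_prepend eval_ext_plus eval_ext_mult)
      have tail: "eval_ext ?N (linear_ext (shuffle_word [X j]) (shuffle_word u' v')) =
          ?N [X j] * (?N u' * ?N v')" for j
        by (simp add: eval_ext_linear_ext IH eval_ext_mult)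
      have "eval_ext (nested_sum (t # ts)) (shuffle_word (x # u') (y # v')) =
          eval_ext ?N (shuffle_word (x # u') (y # v'))
          + ?P ?a * eval_ext ?N (shuffle_word u' (y # v')) + ?P ?b *
              eval_ext ?N (shuffle_word (x # u') v')
          + (?P (?a + ?b) * eval_ext ?N (shuffle_word u' v')
          + (\<Sum>j\<in>{0<..<?a + ?b}. fls_const (delta_coeff ?a ?b j) * (?P (?a + ?b - j) *
             eval_ext ?N (linear_ext (shuffle_word [X j]) (shuffle_word u' v')))))"
        using letter_weight_pos[of x] letter_weight_pos[of y]
        by (simp add: Let_def eval_ext.add eval_ext.sum eval_ext.scale pre letter_weight_X
            distrib_left sum.distrib)
      also have "\<dots> = ?N (x # u') * ?N (y # v') + ?P ?a * (?N u' * ?N (y # v'))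
          + ?P ?b * (?N (x # u') * ?N v') + (?P (?a + ?b)
          + (\<Sum>j\<in>{0<..<?a + ?b}. fls_const (delta_coeff ?a ?b j) * (?P (?a + ?b - j) *
              ?N [X j]))) * (?N u' * ?N v')"
        unfolding IH tail by (simp add: distrib_right sum_distrib_right mult.assoc)
      also have "\<dots> = ?N (x # u') * ?N (y # v') + ?P ?a * (?N u' * ?N (y # v'))
          + ?P ?b * (?N (x # u') * ?N v') + (?P ?a * ?P ?b) * (?N u' * ?N v')"
        using power_sum_mult[OF Cons.prems letter_weight_pos letter_weight_pos] by simp
      finally show ?thesis unfolding u v nested_sum.simps(3) by (simp only: algebra_simps)
    qed simp
  qed simp
qed

section \<open>Linear independence of the nested sums\<close>

lemma infinite_UNIV_fls: "infinite (UNIV :: 'a::field fls set)"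
proof
  assume "finite (UNIV :: 'a fls set)"
  moreover have "inj (\<lambda>n. fls_X ^ n :: 'a fls)"
    by (rule injI) (metis fls_X_power_nth of_nat_eq_iff zero_neq_one)
  ultimately show False using finite_imageD[of "\<lambda>n. fls_X ^ n :: 'a fls" UNIV]
    by (metis finite_subset infinite_UNIV_nat subset_UNIV)
qed

text \<open>
  Prolonging the flag by a variable \<open>t\<close> isolates the words starting with a given letter through the
  order of the pole at \<open>t = 0\<close>.
\<close>

lemma nested_sums_independent:
  assumes "finite A" "\<And>ts. flag ts \<Longrightarrow> (\<Sum>u\<in>A. fls_const (c u) * nested_sum ts u) = 0" "w \<in> A"
  shows "c w = (0 :: 'a::{field, finite})"
  using assms
proof (induction w arbitrary: A c)
  case Nil
  \<comment> \<open>On the empty flag only the empty word has a nonzero value.\<close>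
  have "0 = (\<Sum>u\<in>A. fls_const (c u) * nested_sum [] u)" using Nil(2)[of "[]"] by simp
  also have "\<dots> = (\<Sum>u\<in>A. if u = [] then fls_const (c u) else 0)" by (rule sum.cong) auto
  also have "\<dots> = fls_const (c [])" using Nil by simp
  finally show ?case by simp
next
  case (Cons x w)
  let ?A = "\<lambda>a. {v. X a # v \<in> A}"
  have finA: "finite (?A a)" for a
    by (rule finite_subset[of _ "tl ` A"]) (use Cons(2) in force)+
  let ?H = "(\<lambda>u. letter_weight (hd u)) ` (A - {[]})"
  have xX: "X (letter_weight x) = x" by (rule letter_weight_inverse)
  have C: "(\<Sum>v\<in>?A a. fls_const (c (X a # v)) * nested_sum ts v) = 0"
    if fl: "flag ts" and a: "a \<in> ?H" for ts :: "'a fls list" and a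
  proof (rule principal_parts_independent[where W="flag_span ts" and A="?H"
        and C="\<lambda>a. \<Sum>v\<in>?A a. fls_const (c (X a # v)) * nested_sum ts v"])
    fix t assume t: "\<And>w. w \<in> flag_span ts \<Longrightarrow> t + w \<noteq> 0"
    have fl': "flag (t # ts)" using t[of "- t"] fl by (auto simp: flag_span_uminus_iff)
    \<comment> \<open>Passing from \<open>ts\<close> to \<open>t # ts\<close> adds exactly the terms
      whose first letter occupies the new level, so the difference isolates the dependence on
      \<open>t\<close>.\<close>
    have "0 = (\<Sum>u\<in>A. fls_const (c u) * nested_sum (t # ts) u) - (\<Sum>u\<in>A. fls_const (c u) *
        nested_sum ts u)"
      using Cons(3)[OF fl] Cons(3)[OF fl'] by simp
    also have "\<dots> = (\<Sum>u\<in>A. fls_const (c u) * (nested_sum (t # ts) u - nested_sum ts u))"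
      by (simp add: sum_subtractf right_diff_distrib)
    also have "\<dots> = (\<Sum>u\<in>A - {[]}. fls_const (c u) * (nested_sum (t # ts) u - nested_sum ts u))"
      by (rule sum.mono_neutral_right) (use Cons(2) in auto)
    also have "\<dots> = (\<Sum>a\<in>?H. \<Sum>u\<in>{u \<in> A - {[]}. letter_weight (hd u) = a}.
        fls_const (c u) * (nested_sum (t # ts) u - nested_sum ts u))"
      using Cons(2) by (intro sum.group[symmetric]) auto
    also have "\<dots> = (\<Sum>a\<in>?H. (\<Sum>v\<in>?A a. fls_const (c (X a # v)) * nested_sum ts v) * power_sum t ts a)"
    proof (rule sum.cong[OF refl])
      fix a assume "a \<in> ?H"
      then have "0 < a" by (auto simp: letter_weight_pos)
      have "(\<Sum>u\<in>{u \<in> A - {[]}. letter_weight (hd u) = a}.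
          fls_const (c u) * (nested_sum (t # ts) u - nested_sum ts u)) =
        (\<Sum>v\<in>?A a. fls_const (c (X a # v)) * nested_sum ts v * power_sum t ts a)"
        by (rule sum.reindex_bij_witness[of _ "\<lambda>v. X a # v" tl])
          (use \<open>0 < a\<close> in \<open>auto simp: neq_Nil_conv letter_weight_X letter_weight_inverse\<close>)
      then show "(\<Sum>u\<in>{u \<in> A - {[]}. letter_weight (hd u) = a}.
          fls_const (c u) * (nested_sum (t # ts) u - nested_sum ts u)) =
        (\<Sum>v\<in>?A a. fls_const (c (X a # v)) * nested_sum ts v) * power_sum t ts a"
        by (simp add: sum_distrib_right)
    qed
    finally show "(\<Sum>a\<in>?H. (\<Sum>v\<in>?A a. fls_const (c (X a # v)) * nested_sum ts v) *
        (\<Sum>w\<in>flag_span ts. inverse (t + w) ^ a)) = 0"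
      by (simp add: power_sum_def)
  qed (use a Cons(2) in \<open>auto simp: infinite_UNIV_fls finite_flag_span zero_in_flag_span\<close>)
  have "letter_weight x \<in> ?H" using Cons(4) by force
  from Cons.IH[of "?A (letter_weight x)" "\<lambda>v. c (X (letter_weight x) # v)", OF finA C[OF _ this]]
  show ?case using Cons(4) by (simp add: xX)
qed

lemma eval_nested_sums_eqI:
  fixes p q :: "word \<Rightarrow>\<^sub>0 'a::{field, finite}"
  assumes "\<And>ts. flag ts \<Longrightarrow> eval_ext (nested_sum ts) p = eval_ext (nested_sum ts) q"
  shows "p = q"
proof -
  have "Poly_Mapping.lookup (p - q) u = 0" for u
  proof (cases "u \<in> Poly_Mapping.keys (p - q)")
    case True
    have "(\<Sum>u\<in>Poly_Mapping.keys (p - q). fls_const (Poly_Mapping.lookup (p - q) u) *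
        nested_sum ts u) = 0"
      if "flag ts" for ts
      using assms[OF that] eval_ext.diff[of "nested_sum ts" p q] by (simp add: eval_ext_def)
    from nested_sums_independent[OF _ this True] show ?thesis by simp
  qed (simp add: in_keys_iff)
  then have "p - q = 0" by (intro poly_mapping_eqI) simp
  then show ?thesis by simp
qed

section \<open>Commutativity and associativity of the shuffle product\<close>

lemma eval_shuffle:
  "eval_ext (nested_sum ts) (shuffle p q) = eval_ext (nested_sum ts) p * eval_ext (nested_sum ts) q"
  if "flag ts"
  by (simp add: shuffle_def bilinear_ext_def eval_ext_linear_ext nested_sum_shuffle[OF that]
      eval_ext_mult eval_ext_mult_right)

lemma shuffle_commute: "shuffle p q = shuffle q p"
  by (rule eval_nested_sums_eqI) (simp add: eval_shuffle mult.commute)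

lemma shuffle_assoc: "shuffle (shuffle p q) r = shuffle p (shuffle q r)"
  by (rule eval_nested_sums_eqI) (simp add: eval_shuffle mult.assoc)

section \<open>The shuffle product as a sum of three products\<close>

declare coproduct_word.simps(2) [simp del]

text \<open>
  \<open>left_shuffle\<close> and \<open>contract\<close> are the triangle and diamond products, except that they vanish when
  the left argument, respectively one of the arguments, is the empty word. With this convention
  the identities below hold without any exception for the empty word.
\<close>

fun left_shuffle_word :: "word \<Rightarrow> word \<Rightarrow> (word \<Rightarrow>\<^sub>0 'a::{field, finite})" where
  "left_shuffle_word [] v = 0"
| "left_shuffle_word (x # u) v = prepend x (shuffle_word u v)"

definition left_shuffle :: "(word \<Rightarrow>\<^sub>0 'a::{field, finite}) \<Rightarrow> (word \<Rightarrow>\<^sub>0 'a) \<Rightarrow> (word \<Rightarrow>\<^sub>0 'a)" where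
  "left_shuffle = bilinear_ext left_shuffle_word"

definition contract :: "(word \<Rightarrow>\<^sub>0 'a::{field, finite}) \<Rightarrow> (word \<Rightarrow>\<^sub>0 'a) \<Rightarrow> (word \<Rightarrow>\<^sub>0 'a)" where
  "contract = bilinear_ext (\<lambda>u v. if u = [] \<or> v = [] then 0 else diamond_word u v)"

text \<open>Accounts for the product of two empty words, on which \<open>left_shuffle\<close> and
  \<open>contract\<close> both vanish.\<close>

definition counit_prod :: "(word \<Rightarrow>\<^sub>0 'a::{field, finite}) \<Rightarrow> (word \<Rightarrow>\<^sub>0 'a) \<Rightarrow> (word \<Rightarrow>\<^sub>0 'a)" where
  "counit_prod = bilinear_ext (\<lambda>u v. if u = [] \<and> v = [] then basis [] else 0)"

lemma bilin_left_shuffle: "bilin left_shuffle"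
  unfolding left_shuffle_def by (rule bilin_bilinear_ext)

lemma bilin_contract: "bilin contract"
  unfolding contract_def by (rule bilin_bilinear_ext)

lemma bilin_counit_prod: "bilin counit_prod"
  unfolding counit_prod_def by (rule bilin_bilinear_ext)

lemmas lin_products_comp [lin_intros] =
  bilin_comp[OF bilin_left_shuffle] bilin_comp[OF bilin_contract] bilin_comp[OF bilin_counit_prod]

lemma shuffle_Nil1 [simp]: "shuffle (basis []) p = p"
  by (rule lin_eqI[where f="\<lambda>p. shuffle (basis []) p" and g="\<lambda>p. p"])
    (intro lin_intros | simp add: shuffle_basis)+

lemma shuffle_Nil2 [simp]: "shuffle p (basis []) = p"
  using shuffle_commute[of p "basis []"] by simp

lemma shuffle_left_commute: "shuffle p (shuffle q r) = shuffle q (shuffle p r)"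
  by (metis shuffle_assoc shuffle_commute)

lemmas shuffle_ac = shuffle_assoc shuffle_commute shuffle_left_commute

lemma left_shuffle_Nil [simp]: "left_shuffle (basis []) q = 0"
  by (rule lin_eqI[where f="\<lambda>q. left_shuffle (basis []) q" and g="\<lambda>q. 0"])
    (intro lin_intros | simp add: left_shuffle_def)+

lemma left_shuffle_prepend: "left_shuffle (prepend x p) q = prepend x (shuffle p q)"
  by (rule bilin_eqI[where F="\<lambda>p q. left_shuffle (prepend x p) q"
        and G="\<lambda>p q. prepend x (shuffle p q)"])
    (intro lin_intros | simp add: left_shuffle_def shuffle_basis)+

lemma left_shuffle_Cons: "left_shuffle (basis (x # u)) q = prepend x (shuffle (basis u) q)"
  using left_shuffle_prepend[of x "basis u" q] by simp

text \<open>Both sides keep the first letter of each word of \<open>p\<close> in front; behind it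
  this is associativity of the shuffle product.\<close>

lemma left_shuffle_assoc: "left_shuffle (left_shuffle p q) r = left_shuffle p (shuffle q r)"
proof (rule lin_eqI[where f="\<lambda>p. left_shuffle (left_shuffle p q) r"
      and g="\<lambda>p. left_shuffle p (shuffle q r)"])
  show "left_shuffle (left_shuffle (basis u) q) r = left_shuffle (basis u) (shuffle q r)" for u
    by (cases u) (simp_all add: left_shuffle_Cons left_shuffle_prepend shuffle_assoc
        bilin_left[OF bilin_left_shuffle])
qed (intro lin_intros)+

lemma contract_Nil1 [simp]: "contract (basis []) q = 0"
  by (rule lin_eqI[where f="\<lambda>q. contract (basis []) q" and g="\<lambda>q. 0"])
    (intro lin_intros | simp add: contract_def)+

lemma contract_Nil2 [simp]: "contract p (basis []) = 0"
  by (rule lin_eqI[where f="\<lambda>p. contract p (basis [])" and g="\<lambda>p. 0"])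
    (intro lin_intros | simp add: contract_def)+

lemma contract_letters:
  "contract (basis [x]) (basis [y]) = basis [X (letter_weight x + letter_weight y)] +
    (\<Sum>j\<in>{0<..<letter_weight x + letter_weight y}. scale (delta_coeff (letter_weight x)
        (letter_weight y) j)
      (basis [X (letter_weight x + letter_weight y - j), X j]))"
  by (simp add: contract_def Let_def)

lemma linear_ext_shuffle_word: "linear_ext (shuffle_word u) p = shuffle (basis u) p"
  by (simp add: shuffle_def bilinear_ext_def)

text \<open>The diamond recursion in a form where the coefficients enter only through the
  contraction of two letters, while the tails are shuffled behind it.\<close>

lemma contract_prepend:
  fixes p q :: "word \<Rightarrow>\<^sub>0 'a::{field, finite}"
  shows "contract (prepend x p) (prepend y q) = left_shuffle (contract (basis [x]) (basis [y]))
      (shuffle p q)"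
proof (rule bilin_eqI[where F="\<lambda>p q. contract (prepend x p) (prepend y q)"
      and G="\<lambda>p q. left_shuffle (contract (basis [x]) (basis [y])) (shuffle p q)"])
  fix u v
  show "contract (prepend x (basis u)) (prepend y (basis v)) =
    left_shuffle (contract (basis [x]) (basis [y])) (shuffle (basis u) (basis v) :: word \<Rightarrow>\<^sub>0 'a)"
    unfolding contract_letters
    by (simp add: bilin_left[OF bilin_left_shuffle] left_shuffle_Cons)
      (simp add: contract_def Let_def linear_ext_shuffle_word flip: shuffle_basis)
qed (intro lin_intros)+

lemma contract_Cons:
  "contract (basis (x # u)) (basis (y # v)) =
    left_shuffle (contract (basis [x]) (basis [y])) (shuffle (basis u) (basis v))"
  using contract_prepend[of x "basis u" y "basis v"] by simp

text \<open>Both sides contract the first letters and shuffle all four remaining pieces behind, in a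
  different order. This interchange law later carries multiplicativity from two letters to words
  beginning with them.\<close>

lemma contract_left_shuffle:
  "contract (left_shuffle p q) (left_shuffle r s) = left_shuffle (contract p r) (shuffle q s)"
proof (rule bilin_eqI[where F="\<lambda>p r. contract (left_shuffle p q) (left_shuffle r s)"
      and G="\<lambda>p r. left_shuffle (contract p r) (shuffle q s)"])
  fix u v
  show "contract (left_shuffle (basis u) q) (left_shuffle (basis v) s) =
    left_shuffle (contract (basis u) (basis v)) (shuffle q s)"
  proof (cases u)
    case u: (Cons x u')
    show ?thesis
    proof (cases v)
      case v: (Cons y v')
      show ?thesis
        unfolding u v left_shuffle_Cons contract_prepend contract_Cons[of x u' y v']
            left_shuffle_assoc
        by (simp add: shuffle_ac)
    qed (simp add: bilin_left[OF bilin_left_shuffle] bilin_right[OF bilin_contract])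
  qed (simp add: bilin_left[OF bilin_left_shuffle] bilin_left[OF bilin_contract])
qed (intro lin_intros)+

text \<open>The shuffle recursion on words, with commutativity turning its second summand into
  \<open>left_shuffle q p\<close>.\<close>

lemma shuffle_decomp:
  fixes p q :: "word \<Rightarrow>\<^sub>0 'a::{field, finite}"
  shows "shuffle p q = left_shuffle p q + left_shuffle q p + contract p q + counit_prod p q"
proof (rule bilin_eqI[where F=shuffle
      and G="\<lambda>p q. left_shuffle p q + left_shuffle q p + contract p q + counit_prod p q"])
  fix u v
  show "shuffle (basis u) (basis v) = left_shuffle (basis u) (basis v)
      + left_shuffle (basis v) (basis u)
    + contract (basis u) (basis v) + (counit_prod (basis u) (basis v) :: word \<Rightarrow>\<^sub>0 'a)"
  proof (cases u)
    case u: (Cons x u')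
    show ?thesis
    proof (cases v)
      case v: (Cons y v')
      have "prepend y (shuffle_word (x # u') v') = prepend y (shuffle_word v' (x # u') :: word \<Rightarrow>\<^sub>0
          'a)"
        using shuffle_commute[of "basis (x # u')" "basis v' :: word \<Rightarrow>\<^sub>0 'a"] by (simp only:
            shuffle_basis)
      then show ?thesis
        by (simp add: u v shuffle_basis left_shuffle_def contract_def counit_prod_def Let_def
            del: diamond_word.simps)
    qed (simp add: u left_shuffle_Cons counit_prod_def)
  next
    case u: Nil
    show ?thesis
      by (cases v) (simp_all add: u left_shuffle_Cons counit_prod_def)
  qed
qed (intro lin_intros bilinD2[OF bilin_shuffle])+

section \<open>The counit on the first tensor factor, and componentwise products\<close>

definition counit_left :: "(word \<times> word \<Rightarrow>\<^sub>0 'a::{field, finite}) \<Rightarrow> (word \<Rightarrow>\<^sub>0 'a)" where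
  "counit_left = linear_ext (\<lambda>(a, b). if a = [] then basis b else 0)"

lemma lin_counit_left: "lin counit_left"
  unfolding counit_left_def by (rule lin_linear_ext)

lemmas lin_counit_left_comp [lin_intros] = lin_comp[OF lin_counit_left]

lemma counit_left_basis: "counit_left (basis (a, b)) = (if a = [] then basis b else 0)"
  by (simp add: counit_left_def)

lemma counit_left_tensor_Nil [simp]: "counit_left (tensor (basis []) q) = q"
  by (rule lin_eqI[where f="\<lambda>q. counit_left (tensor (basis []) q)" and g="\<lambda>q. q"])
    (intro lin_intros | simp add: counit_left_basis)+

lemma counit_left_tensor_prepend [simp]: "counit_left (tensor (prepend x p) q) = 0"
  by (rule bilin_eqI[where F="\<lambda>p q. counit_left (tensor (prepend x p) q)" and G="\<lambda>p q. 0"])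
    (intro lin_intros | simp add: counit_left_basis)+

lemma counit_left_tensor_left_shuffle [simp]: "counit_left (tensor (left_shuffle p q) r) = 0"
proof (rule lin_eqI[where f="\<lambda>p. counit_left (tensor (left_shuffle p q) r)" and g="\<lambda>p. 0"])
  show "counit_left (tensor (left_shuffle (basis u) q) r) = 0" for u
    by (cases u) (simp_all add: left_shuffle_Cons linD[OF lin_counit_left] bilin_left[OF
        bilin_tensor])
qed (intro lin_intros)+

lemma counit_left_tensor_contract [simp]: "counit_left (tensor (contract p q) r) = 0"
proof (rule bilin_eqI[where F="\<lambda>p q. counit_left (tensor (contract p q) r)" and G="\<lambda>p q. 0"])
  show "counit_left (tensor (contract (basis u) (basis v)) r) = 0" for u v
  proof (cases "u = [] \<or> v = []")
    case True
    then show ?thesis by (auto simp: linD[OF lin_counit_left] bilin_left[OF bilin_tensor])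
  next
    case False
    then obtain x u' y v' where "u = x # u'" "v = y # v'" by (auto simp: neq_Nil_conv)
    then show ?thesis by (simp only: contract_Cons[of x u' y v'] counit_left_tensor_left_shuffle)
  qed
qed (intro lin_intros)+

lemma counit_left_tprod_left_shuffle [simp]: "counit_left (tprod left_shuffle g P Q) = 0"
proof (rule bilin_eqI[where F="\<lambda>P Q. counit_left (tprod left_shuffle g P Q)" and G="\<lambda>P Q. 0"])
  show "counit_left (tprod left_shuffle g (basis u) (basis v)) = 0" for u v
    by (cases u; cases v) (simp add: tprod_basis)
qed (intro lin_intros)+

lemma counit_left_tprod_contract [simp]: "counit_left (tprod contract g P Q) = 0"
proof (rule bilin_eqI[where F="\<lambda>P Q. counit_left (tprod contract g P Q)" and G="\<lambda>P Q. 0"])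
  show "counit_left (tprod contract g (basis u) (basis v)) = 0" for u v
    by (cases u; cases v) (simp add: tprod_basis)
qed (intro lin_intros)+

text \<open>\<open>shuffle_decomp\<close> is applied in the first factor only. Its last term needs
  an empty first factor on both sides, and \<open>counit_left\<close> extracts exactly those parts
  of \<open>P\<close> and \<open>Q\<close>.\<close>

lemma tprod_shuffle_decomp:
  fixes P Q :: "word \<times> word \<Rightarrow>\<^sub>0 'a::{field, finite}"
  shows "tprod shuffle shuffle P Q = tprod left_shuffle shuffle P Q + tprod left_shuffle shuffle Q P
    + tprod contract shuffle P Q + tensor (basis []) (shuffle (counit_left P) (counit_left Q))"
proof (rule bilin_eqI[where F="tprod shuffle shuffle" and G="\<lambda>P Q. tprod left_shuffle shuffle P Q
    + tprod left_shuffle shuffle Q P + tprod contract shuffle P Q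
    + tensor (basis []) (shuffle (counit_left P) (counit_left Q))"])
  fix u v :: "word \<times> word"
  obtain a b c d where uv: "u = (a, b)" "v = (c, d)" by (cases u; cases v)
  have "tensor (counit_prod (basis a) (basis c)) (shuffle (basis b) (basis d)) =
      tensor (basis []) (shuffle (counit_left (basis (a, b))) (counit_left (basis (c, d))) :: word
          \<Rightarrow>\<^sub>0 'a)"
    by (auto simp: counit_prod_def counit_left_basis bilin_left[OF bilin_tensor]
        bilin_right[OF bilin_tensor] bilin_left[OF bilin_shuffle] bilin_right[OF bilin_shuffle])
  then show "tprod shuffle shuffle (basis u) (basis v) =
      tprod left_shuffle shuffle (basis u) (basis v)
    + tprod left_shuffle shuffle (basis v) (basis u) + tprod contract shuffle (basis u) (basis v)
    + tensor (basis []) (shuffle (counit_left (basis u)) (counit_left (basis v)) :: word \<Rightarrow>\<^sub>0 'a)"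
    unfolding uv tprod_basis shuffle_decomp[of "basis a"]
    by (simp add: bilin_left[OF bilin_tensor] shuffle_commute[of "basis d"])
qed (intro lin_intros bilinD1[OF bilin_tprod] bilinD2[OF bilin_tprod])+

lemma counit_left_tprod_shuffle:
  "counit_left (tprod shuffle shuffle P Q) = shuffle (counit_left P) (counit_left Q)"
  unfolding tprod_shuffle_decomp by (simp add: linD[OF lin_counit_left])

lemma triangle_word_eq:
  "triangle_word u v = left_shuffle_word u v + (if u = [] then basis v else 0)"
  by (cases "(u, v)" rule: triangle_word.cases) auto

text \<open>The two products differ only where the left word is empty, and the difference
  \<open>K\<close> depends on \<open>P\<close> through \<open>counit_left P\<close>. The hypothesis
  holds for the coproduct of a letter \<open>x\<close> minus \<open>1 \<otimes> x\<close>, so the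
  recursive clause can be restated with \<open>left_shuffle\<close>.\<close>

lemma tprod_triangle:
  fixes P Q :: "word \<times> word \<Rightarrow>\<^sub>0 'a::{field, finite}"
  assumes "counit_left P = 0"
  shows "tprod triangle shuffle P Q = tprod left_shuffle shuffle P Q"
proof -
  define K :: "(word \<Rightarrow>\<^sub>0 'a) \<Rightarrow> (word \<times> word \<Rightarrow>\<^sub>0 'a) \<Rightarrow> (word \<times> word \<Rightarrow>\<^sub>0 'a)" where
    "K = bilinear_ext (\<lambda>b (c, d). tensor (basis c) (shuffle (basis b) (basis d)))"
  have K: "bilin K" unfolding K_def by (rule bilin_bilinear_ext)
  have "tprod triangle shuffle P Q = tprod left_shuffle shuffle P Q + K (counit_left P) Q"
  proof (rule bilin_eqI[where F="tprod triangle shuffle"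
        and G="\<lambda>P Q. tprod left_shuffle shuffle P Q + K (counit_left P) Q"])
    fix u v :: "word \<times> word"
    obtain a b c d where uv: "u = (a, b)" "v = (c, d)" by (cases u; cases v)
    show "tprod triangle shuffle (basis u) (basis v) =
      tprod left_shuffle shuffle (basis u) (basis v) + K (counit_left (basis u)) (basis v)"
      unfolding uv tprod_basis
      by (simp add: triangle_def triangle_word_eq left_shuffle_def counit_left_basis K_def
          bilin_left[OF bilin_tensor] bilin_left[OF K, unfolded K_def])
  qed (intro lin_intros bilinD1[OF bilin_tprod] bilinD2[OF bilin_tprod] bilin_comp[OF K])+
  then show ?thesis by (simp add: assms bilin_left[OF K])
qed

lemma tprod_left_shuffle_unit:
  "tprod left_shuffle shuffle P (basis ([], [])) = P - tensor (basis []) (counit_left P)"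
proof (rule lin_eqI[where f="\<lambda>P. tprod left_shuffle shuffle P (basis ([], []))"
      and g="\<lambda>P. P - tensor (basis []) (counit_left P)"])
  fix u :: "word \<times> word"
  obtain a b where "u = (a, b)" by (cases u)
  then show "tprod left_shuffle shuffle (basis u) (basis ([], [])) =
      basis u - tensor (basis []) (counit_left (basis u))"
    by (cases a) (simp_all add: tprod_basis counit_left_basis left_shuffle_Cons
        bilin_left[OF bilin_tensor] bilin_right[OF bilin_tensor])
qed (intro lin_intros)+

lemma tprod_shuffle_unit: "tprod shuffle shuffle (basis ([], [])) Q = Q"
proof (rule lin_eqI[where f="\<lambda>Q. tprod shuffle shuffle (basis ([], [])) Q" and g="\<lambda>Q. Q"])
  show "tprod shuffle shuffle (basis ([], [])) (basis u) = basis u" for u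
    by (cases u) (simp add: tprod_basis)
qed (intro lin_intros)+

lemma tprod_tensor_Nil_left:
  assumes "\<And>q. f (basis []) q = 0"
  shows "tprod f g (tensor (basis []) p) Q = 0"
proof (rule bilin_eqI[where F="\<lambda>p Q. tprod f g (tensor (basis []) p) Q" and G="\<lambda>p Q. 0"])
  show "tprod f g (tensor (basis []) (basis u)) (basis v) = 0" for u v
    by (cases v) (simp add: tprod_basis assms bilin_left[OF bilin_tensor])
qed (intro lin_intros)+

lemma tprod_tensor_Nil_right:
  assumes "\<And>q. f q (basis []) = 0"
  shows "tprod f g P (tensor (basis []) q) = 0"
proof (rule bilin_eqI[where F="\<lambda>q P. tprod f g P (tensor (basis []) q)" and G="\<lambda>p Q. 0"])
  show "tprod f g (basis v) (tensor (basis []) (basis u)) = 0" for u v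
    by (cases v) (simp add: tprod_basis assms bilin_left[OF bilin_tensor])
qed (intro lin_intros)+

lemma tprod_shuffle_assoc:
  "tprod shuffle shuffle (tprod shuffle shuffle P Q) R =
      tprod shuffle shuffle P (tprod shuffle shuffle Q R)"
  by (intro tprod_assoc bilin_shuffle shuffle_assoc)

lemma tprod_shuffle_commute: "tprod shuffle shuffle P Q = tprod shuffle shuffle Q P"
proof (rule bilin_eqI[where F="tprod shuffle shuffle" and G="\<lambda>P Q. tprod shuffle shuffle Q P"])
  show "tprod shuffle shuffle (basis u) (basis v) = tprod shuffle shuffle (basis v) (basis u)"
      for u v
    by (cases u; cases v) (simp add: tprod_basis shuffle_commute)
qed (intro lin_intros bilinD1[OF bilin_tprod] bilinD2[OF bilin_tprod])+

lemma tprod_left_shuffle_assoc: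
  "tprod left_shuffle shuffle (tprod left_shuffle shuffle P Q) R =
    tprod left_shuffle shuffle P (tprod shuffle shuffle Q R)"
  by (intro tprod_assoc bilin_shuffle bilin_left_shuffle shuffle_assoc left_shuffle_assoc)

lemma tprod_contract_left_shuffle:
  "tprod contract shuffle (tprod left_shuffle shuffle P Q) (tprod left_shuffle shuffle R S) =
    tprod left_shuffle shuffle (tprod contract shuffle P R) (tprod shuffle shuffle Q S)"
  by (intro tprod_interchange bilin_shuffle bilin_left_shuffle bilin_contract contract_left_shuffle)
    (simp add: shuffle_ac)

section \<open>Letters as shuffle products modulo words of depth 2\<close>

text \<open>The difference of \<open>x\<^sub>1 \<squnion> x\<^sub>n\<close> and \<open>x\<^sub>n\<^sub>+\<^sub>1\<close>.\<close>

definition depth2_part :: "nat \<Rightarrow> (word \<Rightarrow>\<^sub>0 'a::{field, finite})" where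
  "depth2_part n = basis [X 1, X n] + basis [X n, X 1]
    + (\<Sum>j\<in>{0<..<Suc n}. scale (delta_coeff 1 n j) (basis [X (Suc n - j), X j]))"

text \<open>Trades a letter for a shuffle of lighter letters, at the price of words of depth 2 and
  the same weight.\<close>

lemma letter_Suc:
  assumes "0 < n"
  shows "basis [X (Suc n)] = shuffle (basis [X 1]) (basis [X n]) - depth2_part n"
  using assms by (simp add: shuffle_basis depth2_part_def Let_def letter_weight_X)

lemma coproduct_letter_Suc:
  assumes "0 < n"
  shows "coproduct_word [X (Suc n)] = tprod shuffle shuffle (coproduct_word [X 1]) (coproduct_word
      [X n])
    - coproduct (depth2_part n)"
proof -
  have "coproduct_word [X (Suc n)] = tprod shuffle shuffle (coproduct_word [X 1]) (coproduct_word
      [X n])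
      - coproduct_word [X 1, X n] - coproduct_word [X n, X 1]
      - (\<Sum>j\<in>{0<..<Suc n}. scale (delta_coeff 1 n j) (coproduct_word [X (Suc n - j), X j]))"
    using assms
    by (subst coproduct_word.simps(2))
      (simp add: letter_weight_X Let_def tensor_product_eq_tprod del: coproduct_word.simps(3))
  also have "\<dots> = tprod shuffle shuffle (coproduct_word [X 1]) (coproduct_word [X n])
    - coproduct (depth2_part n)"
    unfolding depth2_part_def linD[OF lin_coproduct] coproduct_basis by (simp only: diff_diff_add
        add.assoc)
  finally show ?thesis .
qed

lemma coproduct_letter_1: "coproduct_word [X 1] = basis ([], [X 1]) + basis ([X 1], [])"
  by (subst coproduct_word.simps(2)) (simp add: letter_weight_X)

lemma letter_cases:
  obtains "x = X 1" | n where "0 < n" "x = X (Suc n)"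
proof (cases "letter_weight x = 1")
  case True
  then show ?thesis using that(1) letter_weight_inverse[of x] by simp
next
  case False
  then show ?thesis
    using that(2)[of "letter_weight x - 1"] letter_weight_inverse[of x] letter_weight_pos[of x] by
        simp
qed

lemma keys_depth2_part:
  assumes "0 < n" "u \<in> Poly_Mapping.keys (depth2_part n :: word \<Rightarrow>\<^sub>0 'a::{field, finite})"
  shows "length u = 2 \<and> weight u = Suc n"
proof -
  have "u \<in> {[X 1, X n], [X n, X 1]} \<union> (\<Union>j\<in>{0<..<Suc n}. {[X (Suc n - j), X j]})"
  proof -
    have "Poly_Mapping.keys (\<Sum>j\<in>{0<..<Suc n}. scale (delta_coeff 1 n j) (basis [X (Suc n
        - j), X j]) :: word \<Rightarrow>\<^sub>0 'a)
        \<subseteq> (\<Union>j\<in>{0<..<Suc n}. {[X (Suc n - j), X j]})"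
      by (rule order.trans[OF Poly_Mapping.keys_sum], rule UN_mono[OF order.refl],
          rule order.trans[OF keys_scale]) simp
    then show ?thesis
      using assms(2) subsetD[OF Poly_Mapping.keys_add[of "basis [X 1, X n]"
          "basis [X n, X 1] :: word \<Rightarrow>\<^sub>0 'a"]]
      unfolding depth2_part_def by (auto dest!: subsetD[OF Poly_Mapping.keys_add])
  qed
  then show ?thesis using assms(1) by (auto simp: letter_weight_X)
qed

section \<open>Grading by weight\<close>

lemma weight_eq_0_iff: "weight u = 0 \<longleftrightarrow> u = []"
  by (cases u) auto

definition homogeneous :: "nat \<Rightarrow> (word \<Rightarrow>\<^sub>0 'a::field) \<Rightarrow> bool" where
  "homogeneous n p \<longleftrightarrow> (\<forall>w\<in>Poly_Mapping.keys p. weight w = n)"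

lemma homogeneous_add: "homogeneous n p \<Longrightarrow> homogeneous n q \<Longrightarrow> homogeneous n (p + q)"
  unfolding homogeneous_def using Poly_Mapping.keys_add[of p q] by blast

lemma homogeneous_scale: "homogeneous n p \<Longrightarrow> homogeneous n (scale c p)"
  unfolding homogeneous_def using keys_scale[of c p] by blast

lemma homogeneous_sum: "(\<And>i. i \<in> I \<Longrightarrow> homogeneous n (f i)) \<Longrightarrow> homogeneous n (sum f I)"
  unfolding homogeneous_def using Poly_Mapping.keys_sum[of f I] by blast

lemma homogeneous_prepend:
  "homogeneous m p \<Longrightarrow> n = letter_weight x + m \<Longrightarrow> homogeneous n (prepend x p)"
  unfolding homogeneous_def using keys_prepend[of x p] by fastforce

lemma homogeneous_linear_ext:
  "homogeneous m p \<Longrightarrow> (\<And>w. weight w = m \<Longrightarrow> homogeneous n (f w)) \<Longrightarrow> homogeneous n (linear_ext f p)"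
  unfolding homogeneous_def using keys_linear_ext[of f p] by blast

lemma homogeneous_shuffle_word:
  "homogeneous (weight u + weight v) (shuffle_word u v :: word \<Rightarrow>\<^sub>0 'a::{field, finite})"
proof (induction "weight u + weight v" arbitrary: u v rule: less_induct)
  case less
  consider "u = []" | "v = []" | x u' y v' where "u = x # u'" "v = y # v'"
    by (cases u; cases v) auto
  then show ?case
  proof cases
    case 3
    let ?a = "letter_weight x" and ?b = "letter_weight y"
    have pos: "0 < ?a" "0 < ?b" by (rule letter_weight_pos)+
    have 1: "homogeneous (weight u' + weight v') (shuffle_word u' v' :: word \<Rightarrow>\<^sub>0 'a)"
      using less[of u' v'] pos 3 by simp
    have 2: "homogeneous (j + (weight u' + weight v'))
        (linear_ext (shuffle_word [X j]) (shuffle_word u' v') :: word \<Rightarrow>\<^sub>0 'a)"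
      if "j \<in> {0<..<?a + ?b}" for j
    proof (rule homogeneous_linear_ext[OF 1])
      show "homogeneous (j + (weight u' + weight v')) (shuffle_word [X j] w :: word \<Rightarrow>\<^sub>0 'a)"
        if "weight w = weight u' + weight v'" for w
        using less[of "[X j]" w] \<open>j \<in> _\<close> that 3 by (simp add: letter_weight_X)
    qed
    show ?thesis
      using pos less[of u' v] less[of u v'] unfolding 3 shuffle_word.simps diamond_word.simps
          Let_def
      by (intro homogeneous_add homogeneous_sum homogeneous_scale)
        (auto intro: homogeneous_prepend[OF _] homogeneous_prepend[OF 1] homogeneous_prepend[OF 2]
          simp: 3 letter_weight_X)
  qed (simp_all add: homogeneous_def)
qed

lemma weight_shuffle_word:
  "w \<in> Poly_Mapping.keys (shuffle_word u v :: word \<Rightarrow>\<^sub>0 'a::{field, finite}) \<Longrightarrow>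
    weight w = weight u + weight v"
  using homogeneous_shuffle_word[of u v, where 'a='a] by (simp add: homogeneous_def)

section \<open>The counit property and the reduced coproduct\<close>

lemma counit_coproduct_word: "counit_left (coproduct_word u) =
    (basis u :: word \<Rightarrow>\<^sub>0 'a::{field, finite})"
\<comment> \<open>The measure that makes the coproduct terminate: a letter ranks above the words of
  depth 2 of its own weight, to which its defining clause refers.\<close>
proof (induction "2 * weight u + (if length u = 1 then 1 else 0)" arbitrary: u rule: less_induct)
  case less
  show ?case
  proof (cases u rule: coproduct_word.cases)
    case 1
    then show ?thesis by (simp add: counit_left_basis)
  next
    case (2 x)
    show ?thesis
    proof (cases x rule: letter_cases)
      case 1
      then show ?thesis
        by (simp add: 2 coproduct_letter_1 linD[OF lin_counit_left] counit_left_basis del: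
            One_nat_def)
    next
      case (2 n)
      have u: "u = [X (Suc n)]" using 2 \<open>u = [x]\<close> by simp
      have "counit_left (coproduct (depth2_part n)) = (depth2_part n :: word \<Rightarrow>\<^sub>0 'a)"
      proof (rule linear_eq_on_keys[where s=scale and f="\<lambda>p. counit_left (coproduct p)"
          and g="\<lambda>p. p"])
        fix v assume "v \<in> Poly_Mapping.keys (depth2_part n :: word \<Rightarrow>\<^sub>0 'a)"
        with keys_depth2_part[OF 2(1) this] show "counit_left (coproduct (basis v)) =
            (basis v :: word \<Rightarrow>\<^sub>0 'a)"
          using less[of v] by (simp add: u letter_weight_X)
      qed (intro lin_intros)+
      moreover have "counit_left (coproduct_word [X 1]) = (basis [X 1] :: word \<Rightarrow>\<^sub>0 'a)"
        "counit_left (coproduct_word [X n]) = (basis [X n] :: word \<Rightarrow>\<^sub>0 'a)"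
        using less[of "[X 1]"] less[of "[X n]"] 2 by (simp_all add: u letter_weight_X)
      ultimately show ?thesis
        using 2(1) unfolding u
        by (simp only: coproduct_letter_Suc linD[OF lin_counit_left] counit_left_tprod_shuffle
            letter_Suc)
    qed
  next
    case (3 x y v)
    have x: "counit_left (coproduct_word [x]) = (basis [x] :: word \<Rightarrow>\<^sub>0 'a)"
      using less[of "[x]"] 3 letter_weight_pos[of y] by simp
    have "counit_left (coproduct_word [x] - basis ([], [x]) :: _ \<Rightarrow>\<^sub>0 'a) = 0"
      by (simp add: linD[OF lin_counit_left] x counit_left_basis)
    then show ?thesis
      by (simp add: 3 tensor_product_eq_tprod tprod_triangle linD[OF lin_counit_left]
          counit_left_basis)
  qed
qed

lemma counit_coproduct: "counit_left (coproduct p) = p"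
  by (rule lin_eqI[where f="\<lambda>p. counit_left (coproduct p)" and g="\<lambda>p. p"])
    (intro lin_intros | simp add: counit_coproduct_word)+

text \<open>Unlike in the usual reduced coproduct, \<open>p \<otimes> 1\<close> is not subtracted.
  What remains is the sum written \<open>a_u \<otimes> b_u\<close> in the recursive clause, and it
  has no part with empty first factor.\<close>

definition reduced_coproduct :: "(word \<Rightarrow>\<^sub>0 'a::{field, finite}) \<Rightarrow> (word \<times> word \<Rightarrow>\<^sub>0 'a)" where
  "reduced_coproduct p = coproduct p - tensor (basis []) p"

lemma lin_reduced_coproduct: "lin reduced_coproduct"
  unfolding reduced_coproduct_def by (intro lin_intros)

lemmas lin_reduced_coproduct_comp [lin_intros] = lin_comp[OF lin_reduced_coproduct]

lemma coproduct_eq: "coproduct p = tensor (basis []) p + reduced_coproduct p"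
  by (simp add: reduced_coproduct_def)

lemma counit_reduced_coproduct: "counit_left (reduced_coproduct p) = 0"
  by (simp add: reduced_coproduct_def linD[OF lin_counit_left] counit_coproduct)

lemma reduced_coproduct_Nil [simp]: "reduced_coproduct (basis []) = 0"
  by (simp add: reduced_coproduct_def)

text \<open>The recursive clause for words, extended to a single letter:
  \<open>1 \<otimes> 1\<close> acts as a right unit on elements killed by
  \<open>counit_left\<close>.\<close>

lemma reduced_coproduct_prepend:
  fixes p :: "word \<Rightarrow>\<^sub>0 'a::{field, finite}"
  shows "reduced_coproduct (prepend x p) =
    tprod left_shuffle shuffle (reduced_coproduct (basis [x])) (coproduct p)"
proof (rule lin_eqI[where f="\<lambda>p. reduced_coproduct (prepend x p)"
      and g="\<lambda>p. tprod left_shuffle shuffle (reduced_coproduct (basis [x])) (coproduct p)"])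
  show "reduced_coproduct (prepend x (basis u)) =
    tprod left_shuffle shuffle (reduced_coproduct (basis [x])) (coproduct (basis u :: word \<Rightarrow>\<^sub>0
        'a))" for u
  proof (cases u)
    case Nil
    then show ?thesis
      by (simp add: tprod_left_shuffle_unit counit_reduced_coproduct bilin_right[OF bilin_tensor])
  next
    case (Cons y v)
    have "counit_left (coproduct_word [x] - basis ([], [x]) :: _ \<Rightarrow>\<^sub>0 'a) = 0"
      using counit_reduced_coproduct[of "basis [x]"] by (simp add: reduced_coproduct_def)
    then show ?thesis
      by (simp add: reduced_coproduct_def Cons tensor_product_eq_tprod tprod_triangle)
  qed
qed (intro lin_intros)+

section \<open>Multiplicativity and coassociativity of the coproduct\<close>

text \<open>A left shuffle of \<open>x # u\<close> with \<open>v\<close> is \<open>x\<close>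
  followed by the shuffle of \<open>u\<close> and \<open>v\<close>, so multiplicativity for that
  lighter pair and \<open>left_shuffle_assoc\<close> give the formula. The condition ranges over
  these pairs only, to be usable inside an induction on total weight.\<close>

lemma reduced_coproduct_left_shuffle_if:
  fixes p q :: "word \<Rightarrow>\<^sub>0 'a::{field, finite}"
  assumes "\<And>x u v. x # u \<in> Poly_Mapping.keys p \<Longrightarrow> v \<in> Poly_Mapping.keys q \<Longrightarrow>
    coproduct (shuffle_word u v) =
      (tprod shuffle shuffle (coproduct_word u) (coproduct_word v) :: word \<times> word \<Rightarrow>\<^sub>0 'a)"
  shows "reduced_coproduct (left_shuffle p q) =
    tprod left_shuffle shuffle (reduced_coproduct p) (coproduct q)"
proof (rule bilin_eq_on_keys[where F="\<lambda>p q. reduced_coproduct (left_shuffle p q)"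
      and G="\<lambda>p q. tprod left_shuffle shuffle (reduced_coproduct p) (coproduct q)"])
  fix u v
  assume keys: "u \<in> Poly_Mapping.keys p" "v \<in> Poly_Mapping.keys q"
  show "reduced_coproduct (left_shuffle (basis u) (basis v)) =
    tprod left_shuffle shuffle (reduced_coproduct (basis u)) (coproduct (basis v :: word \<Rightarrow>\<^sub>0 'a))"
  proof (cases u)
    case Nil
    then show ?thesis
      by (simp add: linD[OF lin_reduced_coproduct] bilin_left[OF bilin_tprod])
  next
    case (Cons x u')
    have mult: "coproduct (shuffle (basis u') (basis v)) =
        tprod shuffle shuffle (coproduct (basis u')) (coproduct (basis v :: word \<Rightarrow>\<^sub>0 'a))"
      using assms[of x u' v] keys by (simp add: Cons shuffle_basis)
    have "reduced_coproduct (basis (x # u')) =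
        tprod left_shuffle shuffle (reduced_coproduct (basis [x])) (coproduct (basis u' :: word
            \<Rightarrow>\<^sub>0 'a))"
      using reduced_coproduct_prepend[of x "basis u'"] by simp
    then show ?thesis
      unfolding Cons left_shuffle_Cons reduced_coproduct_prepend mult
      by (simp only: tprod_left_shuffle_assoc)
  qed
qed (intro lin_intros)+

text \<open>
  Both sides of multiplicativity split as in \<open>shuffle_decomp\<close>, and all parts but the contraction
  agree by hypothesis.
\<close>

lemma coproduct_shuffle_iff:
  fixes p q :: "word \<Rightarrow>\<^sub>0 'a::{field, finite}"
  assumes "reduced_coproduct (left_shuffle p q) =
      tprod left_shuffle shuffle (reduced_coproduct p) (coproduct q)"
    and "reduced_coproduct (left_shuffle q p) =
      tprod left_shuffle shuffle (reduced_coproduct q) (coproduct p)"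
  shows "coproduct (shuffle p q) = tprod shuffle shuffle (coproduct p) (coproduct q) \<longleftrightarrow>
    reduced_coproduct (contract p q) =
      tprod contract shuffle (reduced_coproduct p) (reduced_coproduct q)"
proof -
  have "reduced_coproduct (counit_prod p q) = 0"
  proof (rule bilin_eqI[where F="\<lambda>p q. reduced_coproduct (counit_prod p q)" and G="\<lambda>p q. 0"])
    show "reduced_coproduct (counit_prod (basis u) (basis v)) = 0" for u v
      by (simp add: counit_prod_def linD[OF lin_reduced_coproduct])
  qed (intro lin_intros)+
  then have "coproduct (shuffle p q) = tensor (basis []) (shuffle p q)
      + (reduced_coproduct (left_shuffle p q) + reduced_coproduct (left_shuffle q p)
      + reduced_coproduct (contract p q))"
    unfolding coproduct_eq shuffle_decomp[of p q] linD[OF lin_reduced_coproduct] by simp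
  \<comment> \<open>A left argument \<open>1 \<otimes> r\<close> is annihilated, so the full
    coproduct may be exchanged for the reduced one there.\<close>
  moreover have "tprod left_shuffle shuffle (coproduct r) Q =
      tprod left_shuffle shuffle (reduced_coproduct r) Q"
    for r :: "word \<Rightarrow>\<^sub>0 'a" and Q
    unfolding coproduct_eq by (simp add: bilin_left[OF bilin_tprod] tprod_tensor_Nil_left)
  moreover have "tprod contract shuffle (coproduct p) (coproduct q) =
      tprod contract shuffle (reduced_coproduct p) (reduced_coproduct q)"
    unfolding coproduct_eq
    by (simp add: bilin_left[OF bilin_tprod] bilin_right[OF bilin_tprod]
        tprod_tensor_Nil_left tprod_tensor_Nil_right)
  ultimately show ?thesis
    unfolding tprod_shuffle_decomp counit_coproduct assms[symmetric] by (auto simp: algebra_simps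
        assms)
qed

text \<open>The type argument fixes the coefficient field, which the two words do not
  determine.\<close>

abbreviation multiplicative :: "'a::{field, finite} itself \<Rightarrow> word \<Rightarrow> word \<Rightarrow> bool" where
  "multiplicative _ u v \<equiv> coproduct (shuffle_word u v) =
    (tprod shuffle shuffle (coproduct_word u) (coproduct_word v) :: word \<times> word \<Rightarrow>\<^sub>0 'a)"

text \<open>By \<open>coproduct_shuffle_iff\<close> only the contraction has to be checked. It is a
  left shuffle of the contracted letters with the shuffled tails; the letters are covered by
  hypothesis, the tails are lighter, and \<open>tprod_contract_left_shuffle\<close> reassembles the
  result.\<close>

lemma multiplicative_Cons:
  assumes IH: "\<And>u' v'. weight u' + weight v' < weight (x # u) + weight (y # v) \<Longrightarrow>
      multiplicative TYPE('a::{field, finite}) u' v'"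
    and letters: "multiplicative TYPE('a) [x] [y]"
  shows "multiplicative TYPE('a) (x # u) (y # v)"
proof -
  let ?b = "basis :: word \<Rightarrow> (word \<Rightarrow>\<^sub>0 'a)"
  let ?c = "contract (?b [x]) (?b [y])"
  have pos: "0 < letter_weight x" "0 < letter_weight y" by (rule letter_weight_pos)+
  have D: "reduced_coproduct (left_shuffle (?b (x' # u')) (?b v')) =
      tprod left_shuffle shuffle (reduced_coproduct (?b (x' # u'))) (coproduct (?b v'))"
    if "weight u' + weight v' < weight (x # u) + weight (y # v)" for x' u' v'
    by (rule reduced_coproduct_left_shuffle_if) (use IH[OF that] in auto)
  \<comment> \<open>Used in both directions: for the letters alone, from the product to the
    contraction, and for the full words, back to the product.\<close>
  have iff: "coproduct (shuffle (?b (x # u')) (?b (y # v'))) =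
      tprod shuffle shuffle (coproduct (?b (x # u'))) (coproduct (?b (y # v'))) \<longleftrightarrow>
    reduced_coproduct (contract (?b (x # u')) (?b (y # v'))) =
      tprod contract shuffle (reduced_coproduct (?b (x # u'))) (reduced_coproduct (?b (y # v')))"
    if "weight u' \<le> weight u" "weight v' \<le> weight v" for u' v'
    by (intro coproduct_shuffle_iff D) (use that pos in auto)
  have c: "reduced_coproduct ?c =
      tprod contract shuffle (reduced_coproduct (?b [x])) (reduced_coproduct (?b [y]))"
    using iff[of "[]" "[]"] letters by (simp add: shuffle_basis del: shuffle_word.simps)
  have uv: "coproduct (shuffle (?b u) (?b v)) =
      tprod shuffle shuffle (coproduct (?b u)) (coproduct (?b v))"
    using IH[of u v] pos by (simp add: shuffle_basis)
  have red: "reduced_coproduct (?b (z # w)) =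
      tprod left_shuffle shuffle (reduced_coproduct (?b [z])) (coproduct (?b w))" for z w
    using reduced_coproduct_prepend[of z "?b w"] by simp
  have "reduced_coproduct (contract (?b (x # u)) (?b (y # v))) =
      reduced_coproduct (left_shuffle ?c (shuffle (?b u) (?b v)))"
    by (simp only: contract_Cons[of x u y v])
  also have "\<dots> = tprod left_shuffle shuffle (reduced_coproduct ?c) (coproduct (shuffle (?b u) (?b
      v)))"
  proof (rule reduced_coproduct_left_shuffle_if)
    \<comment> \<open>Contraction and shuffle preserve weight, so dropping the first letter
      \<open>z\<close> leaves a pair of smaller total weight.\<close>
    fix z u' v'
    assume "z # u' \<in> Poly_Mapping.keys ?c" "v' \<in> Poly_Mapping.keys (shuffle (?b u) (?b v))"
    then have v': "weight v' = weight u + weight v" and u': "weight u' < letter_weight x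
        + letter_weight y"
    proof -
      show "weight v' = weight u + weight v"
        using weight_shuffle_word \<open>v' \<in> _\<close> by (simp add: shuffle_basis)
      have "homogeneous (letter_weight x + letter_weight y) ?c"
        unfolding contract_letters
        by (intro homogeneous_add homogeneous_sum homogeneous_scale)
          (use pos in \<open>auto simp: homogeneous_def letter_weight_X\<close>)
      then show "weight u' < letter_weight x + letter_weight y"
        using \<open>z # u' \<in> _\<close> letter_weight_pos[of z] by (auto simp: homogeneous_def)
    qed
    show "multiplicative TYPE('a) u' v'" by (rule IH) (use u' v' in simp)
  qed
  also have "\<dots> = tprod contract shuffle (reduced_coproduct (?b (x # u))) (reduced_coproduct (?b (y
      # v)))"
    unfolding c uv red[of x u] red[of y v] tprod_contract_left_shuffle ..
  finally show ?thesis
    using iff[of u v] by (simp only: shuffle_basis coproduct_basis simp_thms order.refl)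
qed

lemma multiplicative_letter_1:
  assumes "0 < n"
  shows "multiplicative TYPE('a::{field, finite}) [X 1] [X n]"
proof -
  have "shuffle_word [X 1] [X n] = basis [X (Suc n)] + (depth2_part n :: word \<Rightarrow>\<^sub>0 'a)"
    using letter_Suc[OF assms, where 'a='a] by (simp only: shuffle_basis diff_add_cancel)
  then show ?thesis
    using coproduct_letter_Suc[OF assms, where 'a='a]
    by (simp only: linD[OF lin_coproduct] coproduct_basis diff_add_cancel)
qed

lemma coproduct_shuffle_on_keys:
  fixes p q :: "word \<Rightarrow>\<^sub>0 'a::{field, finite}"
  assumes "\<And>u v. u \<in> Poly_Mapping.keys p \<Longrightarrow> v \<in> Poly_Mapping.keys q \<Longrightarrow> multiplicative TYPE('a) u v"
  shows "coproduct (shuffle p q) = tprod shuffle shuffle (coproduct p) (coproduct q)"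
  by (rule bilin_eq_on_keys[where F="\<lambda>p q. coproduct (shuffle p q)"
        and G="\<lambda>p q. tprod shuffle shuffle (coproduct p) (coproduct q)"])
    (intro lin_intros | simp add: shuffle_basis assms)+

lemma multiplicative_all: "multiplicative TYPE('a::{field, finite}) u v"
proof (induction "weight u + weight v" arbitrary: u v rule: less_induct)
  case less
  note IH = less
  let ?b = "basis :: word \<Rightarrow> (word \<Rightarrow>\<^sub>0 'a)"
  let ?n = "weight u + weight v"
  \<comment> \<open>For nonempty words of which one has depth greater than 1, the two first letters
    weigh less than the whole pair, so \<open>multiplicative_Cons\<close> reduces the claim to
    smaller total weight.\<close>
  have deep: "multiplicative TYPE('a) u' v'"
    if total: "weight u' + weight v' \<le> ?n" and len: "length u' > 1 \<or> length v' > 1" for u' v'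
  proof (cases "u' = [] \<or> v' = []")
    case True
    then show ?thesis
      by (auto simp: tprod_shuffle_unit tprod_shuffle_commute[of _ "basis ([], [])"])
  next
    case False
    then obtain x s y t where *: "u' = x # s" "v' = y # t" by (auto simp: neq_Nil_conv)
    have "s \<noteq> [] \<or> t \<noteq> []" using len by (auto simp: *)
    then have pos: "0 < weight s + weight t" using weight_eq_0_iff[of s] weight_eq_0_iff[of t] by
        auto
    show ?thesis
      unfolding * by (rule multiplicative_Cons; rule IH) (use total pos in \<open>auto simp: *\<close>)
  qed
  \<comment> \<open>The letter of weight a + 1 is replaced by means of \<open>letter_Suc\<close>,
    and associativity moves \<open>X 1\<close> to the outside, where multiplicativity holds by
    definition of the coproduct.\<close>
  have letters: "multiplicative TYPE('a) [X a] [X b]" if "0 < a" "0 < b" "a + b = ?n" for a b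
    using that
  proof (induction a arbitrary: b)
    case (Suc a)
    show ?case
    proof (cases "a = 0")
      case True
      then show ?thesis using multiplicative_letter_1[OF Suc(3)] by simp
    next
      case False
      let ?T = "tprod shuffle shuffle :: (word \<times> word \<Rightarrow>\<^sub>0 'a) \<Rightarrow> _"
      have a: "0 < a" using False by simp
      \<comment> \<open>The words in the inner shuffle are either of depth greater than 1, handled
        by \<open>deep\<close> at the current total weight, or the letter of weight a + b, handled
        by \<open>multiplicative_letter_1\<close>.\<close>
      have M1: "coproduct (shuffle (?b [X 1]) (shuffle (?b [X a]) (?b [X b]))) =
          ?T (coproduct (?b [X 1])) (coproduct (shuffle (?b [X a]) (?b [X b])))"
      proof (rule coproduct_shuffle_on_keys)
        fix s t
        assume s: "s \<in> Poly_Mapping.keys (?b [X 1])"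
          and t: "t \<in> Poly_Mapping.keys (shuffle (?b [X a]) (?b [X b]))"
        have wt: "weight t = a + b"
          using weight_shuffle_word[of t "[X a]" "[X b]", where 'a='a] t a Suc(3)
          by (simp add: shuffle_basis letter_weight_X del: shuffle_word.simps)
        have s1: "s = [X 1]" using s by simp
        show "multiplicative TYPE('a) s t"
        proof (cases "length t > 1")
          case True
          then show ?thesis
            by (intro deep) (use s1 wt Suc(4) in \<open>simp_all add: letter_weight_X\<close>)
        next
          case False
          then obtain z where z: "t = [z]"
            using wt a by (cases t) auto
          have "t = [X (a + b)]" using wt letter_weight_inverse[of z] by (simp add: z)
          then show ?thesis using multiplicative_letter_1[of "a + b"] a by (simp only: s1) simp
        qed
      qed
      have M2: "coproduct (shuffle (?b [X a]) (?b [X b])) =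
          ?T (coproduct (?b [X a])) (coproduct (?b [X b]))"
        "coproduct (shuffle (?b [X 1]) (?b [X a])) = ?T (coproduct (?b [X 1])) (coproduct (?b [X
            a]))"
        unfolding shuffle_basis coproduct_basis
        by (rule IH, use a Suc(3,4) in \<open>simp add: letter_weight_X\<close>)+
      have M3: "coproduct (shuffle (depth2_part a) (?b [X b])) =
          ?T (coproduct (depth2_part a)) (coproduct (?b [X b]))"
      proof (rule coproduct_shuffle_on_keys)
        fix s t
        assume s: "s \<in> Poly_Mapping.keys (depth2_part a :: word \<Rightarrow>\<^sub>0 'a)"
          and t: "t \<in> Poly_Mapping.keys (?b [X b])"
        show "multiplicative TYPE('a) s t"
          using keys_depth2_part[OF a s] t Suc(3,4) by (intro deep) (simp_all add: letter_weight_X)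
      qed
      have "coproduct (shuffle (?b [X (Suc a)]) (?b [X b])) =
          coproduct (shuffle (shuffle (?b [X 1]) (?b [X a])) (?b [X b]))
          - coproduct (shuffle (depth2_part a) (?b [X b]))"
        unfolding letter_Suc[OF a] by (simp only: bilin_left[OF bilin_shuffle] linD[OF
            lin_coproduct])
      also have "\<dots> = ?T (coproduct (shuffle (?b [X 1]) (?b [X a]))
          - coproduct (depth2_part a)) (coproduct (?b [X b]))"
        unfolding shuffle_assoc M1 M2 M3 by (simp only: tprod_shuffle_assoc bilin_left[OF
            bilin_tprod])
      also have "\<dots> = ?T (coproduct (?b [X (Suc a)])) (coproduct (?b [X b]))"
        unfolding letter_Suc[OF a] by (simp only: linD[OF lin_coproduct])
      finally show ?thesis by (simp only: shuffle_basis coproduct_basis)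
    qed
  qed simp
  show ?case
  proof (cases "length u > 1 \<or> length v > 1")
    case True
    then show ?thesis by (intro deep) simp_all
  next
    case False
    show ?thesis
    proof (cases "u = [] \<or> v = []")
      case True
      then show ?thesis
        by (auto simp: tprod_shuffle_unit tprod_shuffle_commute[of _ "basis ([], [])"])
    next
      case nonempty: False
      then obtain x y where uv: "u = [x]" "v = [y]"
        using False by (cases u; cases v) auto
      then show ?thesis
        using letters[of "letter_weight x" "letter_weight y"]
        by (simp only: letter_weight_inverse letter_weight_pos weight_simps add_0_right)
    qed
  qed
qed

lemma coproduct_shuffle:
  "coproduct (shuffle p q) = tprod shuffle shuffle (coproduct p) (coproduct q)"
  by (rule coproduct_shuffle_on_keys) (rule multiplicative_all)

lemma reduced_coproduct_left_shuffle:
  "reduced_coproduct (left_shuffle p q) =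
    tprod left_shuffle shuffle (reduced_coproduct p) (coproduct q)"
  by (rule reduced_coproduct_left_shuffle_if) (rule multiplicative_all)

section \<open>Coassociativity\<close>

abbreviation (input) coassoc_left :: "(word \<Rightarrow>\<^sub>0 'a::{field, finite}) \<Rightarrow> (word \<times> word \<times> word \<Rightarrow>\<^sub>0 'a)" where
  "coassoc_left p \<equiv> tensor_map id coproduct (coproduct p)"

abbreviation (input) coassoc_right :: "(word \<Rightarrow>\<^sub>0 'a::{field, finite}) \<Rightarrow> (word \<times> word \<times> word \<Rightarrow>\<^sub>0 'a)" where
  "coassoc_right p \<equiv> tensor_assoc (tensor_map coproduct id (coproduct p))"

abbreviation reduced_left :: "(word \<Rightarrow>\<^sub>0 'a::{field, finite}) \<Rightarrow> (word \<times> word \<times> word \<Rightarrow>\<^sub>0 'a)" where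
  "reduced_left p \<equiv> tensor_map id coproduct (reduced_coproduct p)"

abbreviation reduced_right :: "(word \<Rightarrow>\<^sub>0 'a::{field, finite}) \<Rightarrow> (word \<times> word \<times> word \<Rightarrow>\<^sub>0 'a)" where
  "reduced_right p \<equiv> tensor_assoc (tensor_map reduced_coproduct id (reduced_coproduct p))"

lemma coassoc_left_eq: "coassoc_left p = tensor (basis []) (coproduct p) + reduced_left p"
  by (subst coproduct_eq) (simp add: linD[OF lin_tensor_map] tensor_map_tensor lin_id lin_coproduct)

text \<open>Splitting the outer and the inner coproduct leaves
  \<open>1 \<otimes> 1 \<otimes> p\<close> and \<open>1 \<otimes> \<Delta>'(p)\<close>, which add up
  to \<open>1 \<otimes> \<Delta>(p)\<close>. Since \<open>coassoc_left\<close> has the same leading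
  term, coassociativity at \<open>p\<close> amounts to
  \<open>reduced_left p = reduced_right p\<close>.\<close>

lemma coassoc_right_eq: "coassoc_right p = tensor (basis []) (coproduct p) + reduced_right p"
proof -
  have "tensor_assoc (tensor_map coproduct id P) =
      tensor (basis []) P + tensor_assoc (tensor_map reduced_coproduct id P)"
    for P :: "word \<times> word \<Rightarrow>\<^sub>0 'a"
  proof (rule lin_eqI[where f="\<lambda>P. tensor_assoc (tensor_map coproduct id P)"
        and g="\<lambda>P. tensor (basis []) P + tensor_assoc (tensor_map reduced_coproduct id P)"])
    fix u :: "word \<times> word"
    show "tensor_assoc (tensor_map coproduct id (basis u)) =
      tensor (basis []) (basis u :: word \<times> word \<Rightarrow>\<^sub>0 'a)
          + tensor_assoc (tensor_map reduced_coproduct id (basis u))"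
      by (cases u) (simp add: tensor_map_basis coproduct_eq[of "basis _"] bilin_left[OF
          bilin_tensor]
          linD[OF lin_tensor_assoc] tensor_assoc_basis del: coproduct_basis)
  qed (intro lin_intros)+
  then have "coassoc_right p = tensor (basis []) (reduced_coproduct p) + reduced_right p
      + tensor_assoc (tensor (tensor (basis []) (basis [])) p)"
    by (subst coproduct_eq) (simp add: linD[OF lin_tensor_map] linD[OF lin_tensor_assoc]
        tensor_map_tensor lin_id lin_coproduct)
  then show ?thesis
    by (simp only: tensor_assoc_tensor coproduct_eq[of p] bilin_right[OF bilin_tensor])
      (simp add: add_ac)
qed

text \<open>Multiplicativity is used twice, for the outer coproduct and for the inner one in the
  second factor.\<close>

lemma coassoc_left_shuffle:
  "coassoc_left (shuffle p q) =
    tprod shuffle (tprod shuffle shuffle) (coassoc_left p) (coassoc_left q)"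
  unfolding coproduct_shuffle
  by (rule tensor_map_tprod) (simp_all add: bilin_shuffle bilin_tprod lin_id lin_coproduct
      coproduct_shuffle)

lemma coassoc_right_shuffle:
  fixes p q :: "word \<Rightarrow>\<^sub>0 'a::{field, finite}"
  shows "coassoc_right (shuffle p q) =
    tprod shuffle (tprod shuffle shuffle) (coassoc_right p) (coassoc_right q)"
proof -
  have "tensor_map coproduct id (tprod shuffle shuffle P Q) =
      tprod (tprod shuffle shuffle) shuffle (tensor_map coproduct id P) (tensor_map coproduct id Q)"
    for P Q :: "word \<times> word \<Rightarrow>\<^sub>0 'a"
    by (rule tensor_map_tprod) (simp_all add: bilin_shuffle bilin_tprod lin_id lin_coproduct
        coproduct_shuffle)
  then show ?thesis
    by (simp only: coproduct_shuffle tensor_assoc_tprod[OF bilin_shuffle bilin_shuffle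
        bilin_shuffle])
qed

lemma reduced_left_prepend:
  "reduced_left (prepend x p) =
    tprod left_shuffle (tprod shuffle shuffle) (reduced_left (basis [x])) (coassoc_left p)"
  unfolding reduced_coproduct_prepend
  by (rule tensor_map_tprod)
    (simp_all add: bilin_shuffle bilin_left_shuffle bilin_tprod lin_id lin_coproduct
        coproduct_shuffle)

text \<open>Here the inner reduced coproduct meets a left shuffle in the first factor, so
  \<open>reduced_coproduct_left_shuffle\<close> takes the place that multiplicativity has in
  \<open>reduced_left_prepend\<close>.\<close>

lemma reduced_right_prepend:
  fixes p :: "word \<Rightarrow>\<^sub>0 'a::{field, finite}"
  shows "reduced_right (prepend x p) =
    tprod left_shuffle (tprod shuffle shuffle) (reduced_right (basis [x])) (coassoc_right p)"
proof -
  have "tensor_map reduced_coproduct id (tprod left_shuffle shuffle P Q) =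
      tprod (tprod left_shuffle shuffle) shuffle (tensor_map reduced_coproduct id P) (tensor_map
          coproduct id Q)"
    for P Q :: "word \<times> word \<Rightarrow>\<^sub>0 'a"
    by (rule tensor_map_tprod) (simp_all add: bilin_shuffle bilin_left_shuffle bilin_tprod lin_id
        lin_coproduct lin_reduced_coproduct reduced_coproduct_left_shuffle)
  then show ?thesis
    by (simp only: reduced_coproduct_prepend tensor_assoc_tprod[OF bilin_left_shuffle
        bilin_shuffle bilin_shuffle])
qed

lemma coassoc_word:
  "coassoc_left (basis u) = (coassoc_right (basis u) :: word \<times> word \<times> word \<Rightarrow>\<^sub>0 'a::{field, finite})"
proof (induction "weight u" arbitrary: u rule: less_induct)
  case less
  let ?b = "basis :: word \<Rightarrow> (word \<Rightarrow>\<^sub>0 'a)"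
  have deep: "coassoc_left (?b (x # v)) = coassoc_right (?b (x # v))"
    if "v \<noteq> []" "weight (x # v) \<le> weight u" for x v
  proof -
    have "0 < weight v" using that weight_eq_0_iff[of v] by simp
    then have "coassoc_left (?b [x]) = coassoc_right (?b [x])" "coassoc_left (?b v) =
        coassoc_right (?b v)"
      using that letter_weight_pos[of x] by (auto intro!: less simp del: coproduct_basis)
    then have "reduced_left (?b [x]) = reduced_right (?b [x])"
      and v: "coassoc_left (?b v) = coassoc_right (?b v)"
      by (simp_all only: coassoc_left_eq[of "?b [x]"] coassoc_right_eq[of "?b [x]"] add_left_cancel)
    then have "reduced_left (prepend x (?b v)) = reduced_right (prepend x (?b v))"
      by (simp only: reduced_left_prepend reduced_right_prepend)
    then show ?thesis
      by (simp only: coassoc_left_eq coassoc_right_eq prepend_basis)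
  qed
  show ?case
  proof (cases u rule: coproduct_word.cases)
    case 1
    then show ?thesis by (simp add: tensor_map_basis tensor_assoc_basis)
  next
    case (2 x)
    show ?thesis
    proof (cases x rule: letter_cases)
      case 1
      have "coproduct (?b u) = basis ([], [X 1]) + basis ([X 1], [])"
        by (simp only: 2 1 coproduct_basis coproduct_letter_1)
      then show ?thesis
        by (simp add: linD[OF lin_tensor_map] linD[OF lin_tensor_assoc] tensor_map_basis
            coproduct_letter_1[unfolded One_nat_def] tensor_assoc_basis
            bilin_left[OF bilin_tensor] bilin_right[OF bilin_tensor])
    next
      case (2 n)
      have u: "u = [X (Suc n)]" using 2 \<open>u = [x]\<close> by simp
      have "coassoc_left (depth2_part n) = coassoc_right (depth2_part n :: word \<Rightarrow>\<^sub>0 'a)"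
      proof (rule linear_eq_on_keys[where s=scale and f="coassoc_left" and g="coassoc_right"])
        fix w assume "w \<in> Poly_Mapping.keys (depth2_part n :: word \<Rightarrow>\<^sub>0 'a)"
        with keys_depth2_part[OF 2(1) this] obtain y v where "w = y # v" "v \<noteq> []" "weight w =
            weight u"
          by (cases w; cases "tl w") (auto simp: u letter_weight_X)
        then show "coassoc_left (?b w) = coassoc_right (?b w)"
          using deep[of v y] by (simp del: coproduct_basis)
      qed (intro lin_intros)+
      moreover have "coassoc_left (?b [X 1]) = coassoc_right (?b [X 1])"
        "coassoc_left (?b [X n]) = coassoc_right (?b [X n])"
        using 2 by (auto intro!: less simp: u letter_weight_X simp del: coproduct_basis)
      \<comment> \<open>Both iterated coproducts are linear and multiplicative, so agreement on
        \<open>X 1\<close>, \<open>X n\<close> and the depth 2 part forces agreement on the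
        letter.\<close>
      moreover have "coassoc_left (?b u) = coassoc_left (shuffle (?b [X 1]) (?b [X n]))
          - coassoc_left (depth2_part n)"
        "coassoc_right (?b u) = coassoc_right (shuffle (?b [X 1]) (?b [X n]))
            - coassoc_right (depth2_part n)"
        unfolding u letter_Suc[OF 2(1)]
        by (simp_all only: linD[OF lin_coproduct] linD[OF lin_tensor_map] linD[OF lin_tensor_assoc])
      ultimately show ?thesis
        by (simp only: coassoc_left_shuffle coassoc_right_shuffle)
    qed
  next
    case (3 x y v)
    then show ?thesis using deep[of "y # v" x] by (simp del: coproduct_basis)
  qed
qed

theorem theorem7p6:
  fixes u :: word
  shows "tensor_map id coproduct (coproduct (basis u :: word \<Rightarrow>\<^sub>0 'a::{field, finite})) =
    tensor_assoc (tensor_map coproduct id (coproduct (basis u :: word \<Rightarrow>\<^sub>0 'a)))"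
  by (rule coassoc_word)

end
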